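(* The number of (isomorphism classes of) fundamental groups of CHW manifolds of complex dimension $7$ with diagonal integral holonomy representation exceeds $48321790784$.
   Context: A flat Kähler manifold of complex dimension $n$ is a quotient $\mathbb{C}^n/\Gamma$ with $\Gamma$ a discrete, cocompact, torsion-free subgroup of $U(n)\ltimes\mathbb{C}^n$ (its fundamental group). A complex Hantzsche-Wendt manifold (CHW manifold) of complex dimension $n$ is a flat Kähler manifold of complex dimension $n$ whose holonomy group is isomorphic to $\mathbb{Z}_2^{n-1}$ and contained in $SU(n)$. There is a short exact sequence $0\to\Lambda\to\Gamma\to\mathbb{Z}_2^{n-1}\to1$ with $\Lambda\cong\mathbb{Z}^{2n}$ the maximal abelian (translation) subgroup; the induced conjugation action of the holonomy group $\mathbb{Z}_2^{n-1}$ on $\Lambda$ is the integral holonomy representation. It is called diagonal if there is a $\mathbb{Z}$-basis of $\Lambda$ in which every element of the holonomy group acts by a diagonal matrix. *)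

theory Defs
  imports
    "HOL-Analysis.Analysis"
    "HOL-Algebra.Left_Coset"
    "HOL-Algebra.Elementary_Groups"
    "HOL-Algebra.Product_Groups"
begin

section \<open>The group of unitary affine maps\<close>

definition conj_transpose :: "complex^'n^'n \<Rightarrow> complex^'n^'n" where
  "conj_transpose A = (\<chi> i j. cnj (A $ j $ i))"

definition unitary_matrix :: "complex^'n^'n \<Rightarrow> bool" where
  "unitary_matrix A \<longleftrightarrow> A ** conj_transpose A = mat 1 \<and> conj_transpose A ** A = mat 1"

definition unitary_group :: "(complex^'n^'n) monoid" where
  "unitary_group = \<lparr>carrier = {A. unitary_matrix A}, mult = (**), one = mat 1\<rparr>"

definition special_unitary :: "(complex^'n^'n) set" where
  "special_unitary = {A. unitary_matrix A \<and> det A = 1}"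

type_synonym 'n affine_pair = "(complex^'n^'n) \<times> (complex^'n)"

text \<open>The pair \<open>(A, a)\<close> stands for the map \<open>z \<mapsto> A z + a\<close>; the product is composition.\<close>

definition unitary_affine :: "('n::finite) affine_pair monoid" where
  "unitary_affine =
     \<lparr>carrier = {g. unitary_matrix (fst g)},
      mult = (\<lambda>g h. (fst g ** fst h, fst g *v snd h + snd g)),
      one = (mat 1, 0)\<rparr>"

section \<open>Flat Kaehler groups\<close>

definition quotient_topology :: "'a topology \<Rightarrow> ('a \<Rightarrow> 'b) \<Rightarrow> 'b topology" where
  "quotient_topology X f =
     topology (\<lambda>U. U \<subseteq> f ` topspace X \<and> openin X {x \<in> topspace X. f x \<in> U})"

definition cocompact :: "('n::finite) affine_pair set \<Rightarrow> bool" where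
  "cocompact \<Gamma> \<longleftrightarrow>
     compact_space (quotient_topology (top_of_set (carrier unitary_affine))
       (\<lambda>g. g <#\<^bsub>unitary_affine\<^esub> \<Gamma>))"

definition torsion_free :: "('a, 'b) monoid_scheme \<Rightarrow> bool" where
  "torsion_free G \<longleftrightarrow>
     (\<forall>x\<in>carrier G. \<forall>k::nat. k > 0 \<longrightarrow> x [^]\<^bsub>G\<^esub> k = \<one>\<^bsub>G\<^esub> \<longrightarrow> x = \<one>\<^bsub>G\<^esub>)"

abbreviation subgroup_of :: "('n::finite) affine_pair set \<Rightarrow>
    ('n::finite) affine_pair monoid" where
  "subgroup_of \<Gamma> \<equiv> unitary_affine\<lparr>carrier := \<Gamma>\<rparr>"

definition flat_kaehler_group :: "('n::finite) affine_pair set \<Rightarrow> bool" where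
  "flat_kaehler_group \<Gamma> \<longleftrightarrow>
     subgroup \<Gamma> unitary_affine \<and> discrete \<Gamma> \<and> cocompact \<Gamma> \<and> torsion_free (subgroup_of \<Gamma>)"

section \<open>Holonomy\<close>

text \<open>For the flat manifold \<open>\<complex>\<^sup>n / \<Gamma>\<close> the holonomy group is the group of linear parts of \<open>\<Gamma>\<close>.\<close>

definition holonomy :: "('n::finite) affine_pair set \<Rightarrow> (complex^'n^'n) set" where
  "holonomy \<Gamma> = fst ` \<Gamma>"

definition chw_group :: "('n::finite) affine_pair set \<Rightarrow> bool" where
  "chw_group \<Gamma> \<longleftrightarrow>
     flat_kaehler_group \<Gamma> \<and>
     unitary_group\<lparr>carrier := holonomy \<Gamma>\<rparr> \<cong>
       product_group {..<CARD('n) - 1} (\<lambda>_. integer_mod_group 2) \<and>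
     holonomy \<Gamma> \<subseteq> special_unitary"

text \<open>The subgroup \<open>\<Lambda>\<close> of translations, written additively as a set of vectors.\<close>

definition translation_lattice :: "('n::finite) affine_pair set \<Rightarrow> (complex^'n) set" where
  "translation_lattice \<Gamma> = {v. (mat 1, v) \<in> \<Gamma>}"

definition int_scale :: "int \<Rightarrow> 'a::real_vector \<Rightarrow> 'a" where
  "int_scale k v = of_int k *\<^sub>R v"

definition int_basis :: "'a::real_vector set \<Rightarrow> 'a set \<Rightarrow> bool" where
  "int_basis B L \<longleftrightarrow>
     finite B \<and> \<not> module.dependent int_scale B \<and> module.span int_scale B = L"

text \<open>
  The holonomy element \<open>fst g\<close> acts on \<open>\<Lambda>\<close> by conjugation with its lift \<open>g\<close>. The matrix of this
  action in the basis \<open>B\<close> is diagonal when every basis vector is sent to an integer multiple of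
  itself.
\<close>

definition diagonal_holonomy_rep :: "('n::finite) affine_pair set \<Rightarrow> bool" where
  "diagonal_holonomy_rep \<Gamma> \<longleftrightarrow>
     (\<exists>B. int_basis B (translation_lattice \<Gamma>) \<and>
        (\<forall>g\<in>\<Gamma>. \<forall>b\<in>B. \<exists>d::int.
           g \<otimes>\<^bsub>unitary_affine\<^esub> (mat 1, b) \<otimes>\<^bsub>unitary_affine\<^esub> inv\<^bsub>unitary_affine\<^esub> g
             = (mat 1, int_scale d b)))"

section \<open>Isomorphism classes\<close>

definition diagonal_chw_groups :: "('n::finite) affine_pair set set" where
  "diagonal_chw_groups = {\<Gamma>. chw_group \<Gamma> \<and> diagonal_holonomy_rep \<Gamma>}"

definition iso_rel :: "(('n::finite) affine_pair set \<times> ('n::finite) affine_pair set) set" where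
  "iso_rel = {(\<Gamma>, \<Delta>). \<Gamma> \<in> diagonal_chw_groups \<and> \<Delta> \<in> diagonal_chw_groups \<and>
     subgroup_of \<Gamma> \<cong> subgroup_of \<Delta>}"

section \<open>Basic facts\<close>

lemma conj_transpose_mult:
  "conj_transpose (A ** B) = conj_transpose B ** conj_transpose A"
  by (simp add: conj_transpose_def matrix_matrix_mult_def vec_eq_iff mult.commute)

lemma conj_transpose_conj_transpose [simp]: "conj_transpose (conj_transpose A) = A"
  by (simp add: conj_transpose_def vec_eq_iff)

lemma unitary_matrix_one: "unitary_matrix (mat 1)"
proof -
  have "conj_transpose (mat 1) = (mat 1 :: complex^'n^'n)"
    by (simp add: conj_transpose_def mat_def vec_eq_iff)
  then show ?thesis by (simp add: unitary_matrix_def)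
qed

lemma unitary_matrix_mult:
  assumes "unitary_matrix A" "unitary_matrix B"
  shows "unitary_matrix (A ** B)"
proof -
  have "(A ** B) ** conj_transpose (A ** B) = A ** (B ** conj_transpose B) ** conj_transpose A"
    by (simp add: conj_transpose_mult matrix_mul_assoc)
  moreover have "conj_transpose (A ** B) ** (A ** B)
      = conj_transpose B ** (conj_transpose A ** A) ** B"
    by (simp add: conj_transpose_mult matrix_mul_assoc)
  ultimately show ?thesis using assms by (simp add: unitary_matrix_def)
qed

lemma unitary_matrix_conj_transpose: "unitary_matrix A \<Longrightarrow> unitary_matrix (conj_transpose A)"
  by (simp add: unitary_matrix_def)

lemma group_unitary_group: "group (unitary_group :: (complex^'n^'n) monoid)"
proof (rule groupI)
  fix x :: "complex^'n^'n" assume "x \<in> carrier unitary_group"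
  then show "\<exists>y\<in>carrier unitary_group. y \<otimes>\<^bsub>unitary_group\<^esub> x = \<one>\<^bsub>unitary_group\<^esub>"
    by (intro bexI[of _ "conj_transpose x"])
      (auto simp: unitary_group_def unitary_matrix_conj_transpose, simp add: unitary_matrix_def)
qed (auto simp: unitary_group_def unitary_matrix_one unitary_matrix_mult matrix_mul_assoc)

lemma group_unitary_affine: "group (unitary_affine :: ('n::finite) affine_pair monoid)"
proof (rule groupI)
  fix x :: "('n::finite) affine_pair" assume x: "x \<in> carrier unitary_affine"
  let ?y = "(conj_transpose (fst x), - (conj_transpose (fst x) *v snd x))"
  have "?y \<in> carrier unitary_affine"
    using x by (simp add: unitary_affine_def unitary_matrix_conj_transpose)
  moreover have "?y \<otimes>\<^bsub>unitary_affine\<^esub> x = \<one>\<^bsub>unitary_affine\<^esub>"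
    using x by (simp add: unitary_affine_def unitary_matrix_def)
  ultimately show "\<exists>y\<in>carrier unitary_affine. y \<otimes>\<^bsub>unitary_affine\<^esub> x = \<one>\<^bsub>unitary_affine\<^esub>"
    by blast
qed (auto simp: unitary_affine_def unitary_matrix_one unitary_matrix_mult matrix_mul_assoc
      matrix_vector_mul_assoc matrix_vector_right_distrib add.assoc)

lemma quotient_map_quotient_topology: "quotient_map X (quotient_topology X f) f"
proof -
  let ?P = "\<lambda>U. U \<subseteq> f ` topspace X \<and> openin X {x \<in> topspace X. f x \<in> U}"
  have "?P (S \<inter> T)" if "?P S" "?P T" for S T
  proof -
    have "{x \<in> topspace X. f x \<in> S \<inter> T} = {x \<in> topspace X. f x \<in> S} \<inter> {x \<in> topspace X. f x \<in> T}"
      by auto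
    with that show ?thesis by auto
  qed
  moreover have "?P (\<Union>K)" if "\<forall>U\<in>K. ?P U" for K
  proof -
    have "{x \<in> topspace X. f x \<in> \<Union>K} = (\<Union>U\<in>K. {x \<in> topspace X. f x \<in> U})" by auto
    with that show ?thesis by auto
  qed
  ultimately have "istopology ?P" unfolding istopology_def by blast
  then have o: "openin (quotient_topology X f) = ?P"
    unfolding quotient_topology_def by (rule topology_inverse')
  have eq: "{x \<in> topspace X. f x \<in> f ` topspace X} = topspace X" by auto
  have "?P (f ` topspace X)" by (simp add: eq)
  then have "topspace (quotient_topology X f) = f ` topspace X"
    unfolding topspace_def[of "quotient_topology X f"] o by blast
  then show ?thesis by (auto simp: quotient_map_def o)
qed

lemma module_int_scale: "module int_scale"
  by unfold_locales (simp_all add: int_scale_def algebra_simps)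

lemma conjugate_translation:
  fixes g :: "'n::finite affine_pair" and v :: "complex^'n"
  assumes "g \<in> carrier unitary_affine"
  shows "g \<otimes>\<^bsub>unitary_affine\<^esub> (mat 1, v) \<otimes>\<^bsub>unitary_affine\<^esub> inv\<^bsub>unitary_affine\<^esub> g
    = (mat 1, fst g *v v)"
proof -
  interpret group "unitary_affine :: ('n::finite) affine_pair monoid"
    by (rule group_unitary_affine)
  have v: "(mat 1, w) \<in> carrier unitary_affine" for w :: "complex^'n"
    by (simp add: unitary_affine_def unitary_matrix_one)
  have "g \<otimes>\<^bsub>unitary_affine\<^esub> (mat 1, v) = (mat 1, fst g *v v) \<otimes>\<^bsub>unitary_affine\<^esub> g"
    by (simp add: unitary_affine_def add.commute)
  then show ?thesis
    using assms v[of v] v[of "fst g *v v"] by (simp add: m_assoc)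
qed

lemma equiv_iso_rel:
  "equiv (diagonal_chw_groups :: ('n::finite) affine_pair set set) iso_rel"
proof (rule equivI)
  have grp: "group (subgroup_of \<Gamma>)" if "\<Gamma> \<in> diagonal_chw_groups"
    for \<Gamma> :: "('n::finite) affine_pair set"
    using that group_unitary_affine
    by (auto simp: diagonal_chw_groups_def chw_group_def flat_kaehler_group_def
        intro: subgroup.subgroup_is_group)
  show "iso_rel \<subseteq> diagonal_chw_groups \<times> (diagonal_chw_groups :: ('n::finite) affine_pair set set)"
    by (auto simp: iso_rel_def)
  show "refl_on diagonal_chw_groups (iso_rel :: (('n::finite) affine_pair set \<times> _) set)"
    by (auto simp: refl_on_def iso_rel_def intro: iso_refl)
  show "sym (iso_rel :: (('n::finite) affine_pair set \<times> _) set)"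
    unfolding sym_def iso_rel_def using group.iso_sym[OF grp] by blast
  show "trans (iso_rel :: (('n::finite) affine_pair set \<times> _) set)"
    unfolding trans_def iso_rel_def using iso_trans by blast
qed

end

theory Submission
  imports Defs "HOL-Library.Z2" "HOL-Library.Function_Algebras"
begin

text \<open>
  To every \<open>u : {1..7}\<^sup>2 \<rightarrow> V\<close>, with \<open>V\<close> the Klein four-group identified with the Gaussian
  integers modulo 2, attach the group of all maps \<open>z \<mapsto> D\<^sub>S z + a\<close> with \<open>S\<close> of even size, \<open>D\<^sub>S\<close> the
  diagonal matrix with entry \<open>- 1\<close> on \<open>S\<close> and \<open>1\<close> off \<open>S\<close>, and
  \<open>2 a\<^sub>i \<equiv> \<Sum>j\<in>S. u i j (mod 2)\<close>. It is torsion-free as soon as for every nonempty even \<open>S\<close>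
  some \<open>i \<notin> S\<close> has \<open>(\<Sum>j\<in>S. u i j) \<noteq> 0\<close>; a union bound shows that at least
  \<open>3\<^sup>7 * 443 * 4\<^sup>3\<^sup>7\<close> of the \<open>4\<^sup>4\<^sup>9\<close> choices of \<open>u\<close> satisfy this.

  An isomorphism of two such groups preserves the translations, since these are the elements
  commuting with all squares. It therefore permutes the even sets compatibly with inclusion
  (inclusion is reverse inclusion of the fixed lattices), hence comes from a permutation \<open>\<pi>\<close> of the
  coordinates, and acts on the \<open>i\<close>-th coordinate through a bijection \<open>M\<^sub>i\<close> of \<open>V\<close> fixing 0. Comparing
  squares gives \<open>v (\<pi> i) (\<pi> j) = M\<^sub>i (u i j) + d\<^sub>i\<close> for \<open>j \<noteq> i\<close>. So an isomorphism class contains at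
  most \<open>7! * 6\<^sup>7 * 4\<^sup>7 * 4\<^sup>7\<close> of the groups, and the quotient of the two numbers is
  \<open>2\<^sup>3\<^sup>5 * 443 / 315 > 48321790784\<close>.
\<close>

section \<open>Counting matrices over the Klein four-group\<close>

instance bit :: finite
proof
  have "(UNIV :: bit set) = {0, 1}"
    by (auto intro: bit.exhaust)
  then show "finite (UNIV :: bit set)"
    by (metis finite.emptyI finite.insertI)
qed

lemma card_bit: "CARD(bit) = 2"
proof -
  have "(UNIV :: bit set) = {0, 1}"
    by (auto intro: bit.exhaust)
  then have "CARD(bit) = card {0 :: bit, 1}" by metis
  then show ?thesis by simp
qed

lemma card_Compl: "card (- A) = CARD('a) - card A" for A :: "'a::finite set"
  by (simp add: Compl_eq_Diff_UNIV card_Diff_subset)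

type_synonym v4 = "bit \<times> bit"

lemma card_v4: "CARD(v4) = 4"
  by (simp add: card_bit)

text \<open>All fibres of a surjective homomorphism are translates of its kernel, so preimages scale
  cardinalities by a constant factor. The product form avoids division.\<close>

lemma card_vimage_hom:
  fixes h :: "'a::{finite,ab_group_add} \<Rightarrow> 'b::{finite,ab_group_add}"
  assumes add: "\<And>x y. h (x + y) = h x + h y" and "surj h"
  shows "card (h -` Y) * CARD('b) = card Y * CARD('a)"
proof -
  have fib: "card (h -` {y}) = card (h -` {0})" for y
  proof -
    obtain x where x: "h x = y" using \<open>surj h\<close> by (metis surjD)
    have diff: "h (z - x) = 0" if "h z = y" for z
      using add[of "z - x" x] x that by simp
    have "h -` {y} = (\<lambda>z. z + x) ` (h -` {0})"
    proof (rule Set.set_eqI, rule iffI)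
      fix z assume "z \<in> h -` {y}"
      then show "z \<in> (\<lambda>z. z + x) ` (h -` {0})"
        using diff[of z] by (intro image_eqI[of _ _ "z - x"]) auto
    qed (auto simp: add x)
    moreover have "inj_on (\<lambda>z. z + x) (h -` {0})" by (simp add: inj_on_def)
    ultimately show ?thesis by (simp add: card_image)
  qed
  have count: "card (h -` Z) = card Z * card (h -` {0})" for Z
  proof -
    have "h -` Z = (\<Union>y\<in>Z. h -` {y})" by auto
    also have "card \<dots> = (\<Sum>y\<in>Z. card (h -` {y}))"
      by (rule card_UN_disjoint) auto
    also have "\<dots> = card Z * card (h -` {0})" by (subst sum.cong[OF refl fib]) simp
    finally show ?thesis by simp
  qed
  have "CARD('a) = CARD('b) * card (h -` {0})" using count[of UNIV] by (simp only: vimage_UNIV)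
  then show ?thesis by (simp only: count[of Y] mult_ac)
qed

definition even_sets :: "'n::finite set set" where
  "even_sets = {S. even (card S)}"

definition weight :: "('n::finite \<Rightarrow> 'n \<Rightarrow> v4) \<Rightarrow> 'n \<Rightarrow> 'n set \<Rightarrow> v4" where
  "weight u i S = (\<Sum>j\<in>S. u i j)"

definition admissible :: "('n::finite \<Rightarrow> 'n \<Rightarrow> v4) \<Rightarrow> bool" where
  "admissible u \<longleftrightarrow> (\<forall>S\<in>even_sets. S \<noteq> {} \<longrightarrow> (\<exists>i. i \<notin> S \<and> weight u i S \<noteq> 0))"

text \<open>The sum over \<open>C\<close> is a surjective homomorphism onto \<open>v4\<close>, and
  three of its four values are allowed.\<close>

lemma card_rows_nonzero:
  fixes C :: "'n::finite set"
  assumes "C \<noteq> {}"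
  shows "card {r :: 'n \<Rightarrow> v4. sum r C \<noteq> 0} * 4 = 3 * 4 ^ CARD('n)"
proof -
  let ?h = "\<lambda>r :: 'n \<Rightarrow> v4. sum r C"
  obtain k where k: "k \<in> C" using assms by blast
  have "surj ?h"
    by (rule surjI[of _ "\<lambda>y j. if j = k then y else 0"]) (use k in simp)
  then have "card (?h -` (- {0})) * CARD(v4) = card (- {0 :: v4}) * CARD('n \<Rightarrow> v4)"
    by (intro card_vimage_hom) (simp_all add: sum.distrib)
  moreover have "?h -` (- {0}) = {r. sum r C \<noteq> 0}" by auto
  moreover have "card (- {0 :: v4}) = 3" by (simp add: card_Compl card_bit)
  ultimately show ?thesis by (simp only: card_v4 card_fun) simp
qed

text \<open>For nonempty \<open>S\<close> properly inside \<open>C\<close> the two sums are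
  independent, and 3 of their 16 joint values are allowed.\<close>

lemma card_rows_nonzero_zero:
  fixes C S :: "'n::finite set"
  assumes "S \<noteq> {}" "S \<subset> C"
  shows "card {r :: 'n \<Rightarrow> v4. sum r C \<noteq> 0 \<and> sum r S = 0} * 16 = 3 * 4 ^ CARD('n)"
proof -
  let ?h = "\<lambda>r :: 'n \<Rightarrow> v4. (sum r C, sum r S)"
  obtain j k where j: "j \<in> S" "j \<in> C" and k: "k \<in> C" "k \<notin> S" using assms by blast
  \<comment> \<open>An entry at \<open>j\<close> counts in both sums, an entry at \<open>k\<close>
    only in the sum over \<open>C\<close>. So \<open>j\<close> carries the prescribed sum over
    \<open>S\<close>, and \<open>k\<close> the difference.\<close>
  have "surj ?h"
    by (rule surjI[of _ "\<lambda>y. (\<lambda>l. if l = j then snd y else 0) + (\<lambda>l. if l = k then fst y - snd y else 0)"])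
      (use j k in \<open>simp add: sum.distrib\<close>)
  then have "card (?h -` ((- {0}) \<times> {0})) * CARD(v4 \<times> v4)
      = card ((- {0 :: v4}) \<times> {0 :: v4}) * CARD('n \<Rightarrow> v4)"
    by (intro card_vimage_hom) (simp_all add: sum.distrib)
  moreover have "?h -` ((- {0}) \<times> {0}) = {r. sum r C \<noteq> 0 \<and> sum r S = 0}" by auto
  moreover have "card ((- {0 :: v4}) \<times> {0 :: v4}) = 3"
    by (simp add: card_cartesian_product card_Compl card_bit)
  ultimately show ?thesis
    by (simp only: card_fun card_cartesian_product UNIV_Times_UNIV[symmetric] card_v4)
      (simp add: card_bit)
qed

section \<open>Counting admissible matrices in dimension seven\<close>

lemma card_functions_pointwise:
  fixes P :: "'n::finite \<Rightarrow> 'b::finite \<Rightarrow> bool"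
  shows "card {u. \<forall>i. P i (u i)} = (\<Prod>i\<in>UNIV. card {r. P i r})"
proof -
  have "{u. \<forall>i. P i (u i)} = PiE UNIV (\<lambda>i. {r. P i r})" by (auto simp: PiE_def Pi_def)
  then show ?thesis by (simp add: card_PiE)
qed

text \<open>The six-element sets are singled out because just one index lies outside each, so each
  of their conditions concerns a single row.\<close>

lemma even_sets_7:
  fixes S :: "7 set"
  assumes "S \<in> even_sets" "S \<noteq> {}"
  shows "card S = 2 \<or> card S = 4 \<or> (\<exists>i. S = - {i})"
proof -
  have "card S \<le> 7" using card_mono[of UNIV S] by simp
  moreover have "even (card S)" "card S \<noteq> 0" using assms by (auto simp: even_sets_def)
  ultimately have "card S = 2 \<or> card S = 4 \<or> card S = 6" by presburger
  moreover have "\<exists>i. S = - {i}" if "card S = 6"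
  proof -
    have "card (- S) = 1" using that by (simp add: card_Compl)
    then obtain i where "- S = {i}" by (auto simp: card_1_singleton_iff)
    then show ?thesis by (metis double_complement)
  qed
  ultimately show ?thesis by blast
qed

lemma card_7_rows_nonzero: "card {r :: 7 \<Rightarrow> v4. sum r (- {i}) \<noteq> 0} = 3 * 4 ^ 6"
proof -
  have "card (- {i}) = 6" by (simp add: card_Compl)
  then have "- {i} \<noteq> {}" by auto
  then show ?thesis using card_rows_nonzero[of "- {i}"] by simp
qed

lemma card_7_rows_nonzero_zero:
  fixes S :: "7 set"
  assumes "S \<noteq> {}" "card S \<le> 4" "i \<notin> S"
  shows "card {r :: 7 \<Rightarrow> v4. sum r (- {i}) \<noteq> 0 \<and> sum r S = 0} = 3 * 4 ^ 5"
proof -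
  have "card (- {i}) = 6" by (simp add: card_Compl)
  then have "S \<noteq> - {i}" using assms by auto
  then have "S \<subset> - {i}" using assms by auto
  then show ?thesis using card_rows_nonzero_zero[of S "- {i}"] assms by simp
qed

text \<open>
  The conditions coming from the six-element sets are independent, and given these, each smaller
  set is bad for an index outside it with probability exactly \<open>1/4\<close>; hence the union bound
  over the \<open>35 + 21\<close> smaller sets loses only the factor \<open>443/1024\<close>.
\<close>

lemma card_admissible: "3 ^ 7 * 443 * 4 ^ 37 \<le> card {u :: 7 \<Rightarrow> 7 \<Rightarrow> v4. admissible u}"
proof -
  \<comment> \<open>\<open>A\<close> collects the matrices meeting the conditions of the six-element
    sets, \<open>B S\<close> those in \<open>A\<close> that violate the condition of
    \<open>S\<close>.\<close>
  define A where "A = {u :: 7 \<Rightarrow> 7 \<Rightarrow> v4. \<forall>i. sum (u i) (- {i}) \<noteq> 0}"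
  define B where "B S = {u :: 7 \<Rightarrow> 7 \<Rightarrow> v4. \<forall>i. sum (u i) (- {i}) \<noteq> 0 \<and>
    (i \<notin> S \<longrightarrow> sum (u i) S = 0)}" for S
  define K where "K k = {S :: 7 set. card S = k}" for k
  have "card A = (\<Prod>i\<in>(UNIV :: 7 set). card {r :: 7 \<Rightarrow> v4. sum r (- {i}) \<noteq> 0})"
    unfolding A_def by (rule card_functions_pointwise)
  then have A: "card A = (3 * 4 ^ 6) ^ 7"
    by (simp only: card_7_rows_nonzero prod_constant) simp
  have B: "card (B S) = 3 ^ 7 * 4 ^ 35 * 4 ^ card S" if S: "S \<noteq> {}" "card S \<le> 4" for S
  proof -
    have "card (B S) = (\<Prod>i\<in>UNIV. card {r :: 7 \<Rightarrow> v4. sum r (- {i}) \<noteq> 0 \<and> (i \<notin> S \<longrightarrow> sum r S = 0)})"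
      unfolding B_def by (rule card_functions_pointwise)
    \<comment> \<open>A row with index outside \<open>S\<close> has a second sum prescribed, which
      costs a factor 4; the rows indexed by \<open>S\<close> keep that factor.\<close>
    also have "\<dots> = (\<Prod>i\<in>UNIV. 3 * 4 ^ 5 * (if i \<in> S then 4 else 1))"
    proof (rule prod.cong[OF refl])
      fix i :: 7
      show "card {r :: 7 \<Rightarrow> v4. sum r (- {i}) \<noteq> 0 \<and> (i \<notin> S \<longrightarrow> sum r S = 0)}
          = 3 * 4 ^ 5 * (if i \<in> S then 4 else 1)"
        using card_7_rows_nonzero[of i] card_7_rows_nonzero_zero[OF S, of i] by (cases "i \<in> S") simp_all
    qed
    also have "\<dots> = (3 * 4 ^ 5) ^ 7 * 4 ^ card S"
      by (simp add: prod.distrib prod.If_cases)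
    finally show ?thesis by (simp add: power_mult_distrib flip: power_mult)
  qed
  have K: "card (K k) = 7 choose k" for k
    using n_subsets[of "UNIV :: 7 set" k] by (simp add: K_def)
  have union: "card (\<Union>S\<in>K k. B S) \<le> (7 choose k) * (3 ^ 7 * 4 ^ 35 * 4 ^ k)" if "k = 2 \<or> k = 4" for k
  proof -
    have "card (\<Union>S\<in>K k. B S) \<le> (\<Sum>S\<in>K k. card (B S))"
      by (rule card_UN_le) simp
    also have "\<dots> = (\<Sum>S\<in>K k. 3 ^ 7 * 4 ^ 35 * 4 ^ k)"
      by (rule sum.cong[OF refl], subst B) (use that in \<open>auto simp: K_def\<close>)
    finally show ?thesis by (simp add: K)
  qed
  have sub: "A - ((\<Union>S\<in>K 2. B S) \<union> (\<Union>S\<in>K 4. B S)) \<subseteq> {u. admissible u}"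
  proof (rule subsetI, rule CollectI, unfold admissible_def, intro ballI impI)
    fix u :: "7 \<Rightarrow> 7 \<Rightarrow> v4" and S :: "7 set"
    assume u: "u \<in> A - ((\<Union>S\<in>K 2. B S) \<union> (\<Union>S\<in>K 4. B S))" and S: "S \<in> even_sets" "S \<noteq> {}"
    have A: "sum (u i) (- {i}) \<noteq> 0" for i using u by (simp add: A_def)
    consider "S \<in> K 2 \<union> K 4" | i where "S = - {i}"
      using even_sets_7[OF S] by (auto simp: K_def)
    then show "\<exists>i. i \<notin> S \<and> weight u i S \<noteq> 0"
    proof cases
      case 1
      then have "u \<notin> B S" using u by blast
      then show ?thesis using A by (auto simp: B_def weight_def)
    next
      case 2
      then show ?thesis using A[of i] by (auto simp: weight_def)
    qed
  qed
  have "card A - (card (\<Union>S\<in>K 2. B S) + card (\<Union>S\<in>K 4. B S))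
      \<le> card (A - ((\<Union>S\<in>K 2. B S) \<union> (\<Union>S\<in>K 4. B S)))"
    using diff_card_le_card_Diff[of "(\<Union>S\<in>K 2. B S) \<union> (\<Union>S\<in>K 4. B S)" A]
      card_Un_le[of "\<Union>S\<in>K 2. B S" "\<Union>S\<in>K 4. B S"] by simp
  also have "\<dots> \<le> card {u :: 7 \<Rightarrow> 7 \<Rightarrow> v4. admissible u}"
    by (rule card_mono[OF _ sub]) simp
  finally have le: "card A \<le> card {u :: 7 \<Rightarrow> 7 \<Rightarrow> v4. admissible u}
      + (7 choose 2) * (3 ^ 7 * 4 ^ 35 * 4 ^ 2) + (7 choose 4) * (3 ^ 7 * 4 ^ 35 * 4 ^ 4)"
    using union[of 2] union[of 4] by linarith
  \<comment> \<open>After division by \<open>3 ^ 7 * 4 ^ 37\<close> there remains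
    \<open>1024 - 21 - 35 * 16 = 443\<close>.\<close>
  have "(7 choose 2) = (21 :: nat)" "(7 choose 4) = (35 :: nat)" by (simp_all add: numeral_eq_Suc)
  then show ?thesis using le unfolding A by simp
qed

section \<open>Gaussian integers modulo 2\<close>

definition gauss_ints :: "complex set" where
  "gauss_ints = {z. Re z \<in> \<int> \<and> Im z \<in> \<int>}"

text \<open>The floor only converts integral real numbers to type \<open>int\<close>; the value is
  meaningful on \<open>gauss_ints\<close>.\<close>

definition mod2 :: "complex \<Rightarrow> v4" where
  "mod2 z = (of_int \<lfloor>Re z\<rfloor>, of_int \<lfloor>Im z\<rfloor>)"

lemma of_int_bit_eq_0_iff: "of_int k = (0 :: bit) \<longleftrightarrow> even k"
proof
  show "of_int k = (0 :: bit)" if "even k" using that by (elim evenE) simp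
  show "even k" if "of_int k = (0 :: bit)"
  proof (rule ccontr)
    assume "odd k"
    then have "of_int k = (1 :: bit)" by (elim oddE) simp
    then show False using that by simp
  qed
qed

lemma gauss_ints_0 [simp]: "0 \<in> gauss_ints"
  and gauss_ints_add [intro]: "x \<in> gauss_ints \<Longrightarrow> y \<in> gauss_ints \<Longrightarrow> x + y \<in> gauss_ints"
  and gauss_ints_diff [intro]: "x \<in> gauss_ints \<Longrightarrow> y \<in> gauss_ints \<Longrightarrow> x - y \<in> gauss_ints"
  and gauss_ints_minus_iff [simp]: "- x \<in> gauss_ints \<longleftrightarrow> x \<in> gauss_ints"
  and gauss_ints_double [intro]: "x \<in> gauss_ints \<Longrightarrow> 2 * x \<in> gauss_ints"
  by (auto simp: gauss_ints_def)

lemma mod2_0 [simp]: "mod2 0 = 0"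
  by (simp add: mod2_def zero_prod_def)

lemma mod2_add: "x \<in> gauss_ints \<Longrightarrow> y \<in> gauss_ints \<Longrightarrow> mod2 (x + y) = mod2 x + mod2 y"
  by (auto simp: mod2_def gauss_ints_def elim!: Ints_cases)

lemma v4_double [simp]: "v + v = 0" for v :: v4
  by (cases v) (simp add: zero_prod_def)

lemma v4_minus [simp]: "- v = v" for v :: v4
  using v4_double by (rule minus_unique)

lemma mod2_minus [simp]: "x \<in> gauss_ints \<Longrightarrow> mod2 (- x) = mod2 x"
  using mod2_add[of x "- x"] by (simp add: eq_neg_iff_add_eq_0[symmetric] add.commute)

lemma mod2_double [simp]: "w \<in> gauss_ints \<Longrightarrow> mod2 (2 * w) = 0"
  using mod2_add[of w w] by (simp flip: mult_2)

lemma mod2_eq_0_iff: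
  assumes "z \<in> gauss_ints"
  shows "mod2 z = 0 \<longleftrightarrow> (\<exists>w\<in>gauss_ints. z = 2 * w)"
proof
  obtain a b where ab: "Re z = of_int a" "Im z = of_int b"
    using assms by (auto simp: gauss_ints_def elim!: Ints_cases)
  assume "mod2 z = 0"
  then have "even a" "even b" by (simp_all add: mod2_def ab zero_prod_def of_int_bit_eq_0_iff)
  then obtain c d where cd: "a = 2 * c" "b = 2 * d" by (auto elim!: evenE)
  have "z = 2 * Complex (of_int c) (of_int d)" using ab cd by (simp add: complex_eq_iff)
  moreover have "Complex (of_int c) (of_int d) \<in> gauss_ints" by (simp add: gauss_ints_def)
  ultimately show "\<exists>w\<in>gauss_ints. z = 2 * w" by blast
next
  assume "\<exists>w\<in>gauss_ints. z = 2 * w"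
  then show "mod2 z = 0" by auto
qed

lemma mod2_surj: "\<exists>z\<in>gauss_ints. mod2 z = v"
proof -
  have "\<exists>k. of_int k = b" for b :: bit
    by (cases b) (auto intro: exI[of _ 0] exI[of _ 1])
  then obtain k l where "of_int k = fst v" "of_int l = snd v" by metis
  then show ?thesis
    by (intro bexI[of _ "Complex (of_int k) (of_int l)"]) (simp_all add: mod2_def gauss_ints_def)
qed

section \<open>Diagonal sign matrices\<close>

definition sign_of :: "'n set \<Rightarrow> 'n \<Rightarrow> complex" where
  "sign_of S i = (if i \<in> S then - 1 else 1)"

definition sign_matrix :: "'n::finite set \<Rightarrow> complex^'n^'n" where
  "sign_matrix S = (\<chi> i j. if i = j then sign_of S i else 0)"

text \<open>This is multiplication of sign matrices read off on index sets: two signs have product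
  \<open>- 1\<close> where exactly one of them is \<open>- 1\<close>.\<close>

definition symm_diff :: "'a set \<Rightarrow> 'a set \<Rightarrow> 'a set" where
  "symm_diff S T = (S - T) \<union> (T - S)"

lemma sign_of_mult: "sign_of S i * sign_of T i = sign_of (symm_diff S T) i"
  by (auto simp: sign_of_def symm_diff_def)

lemma sign_matrix_mult: "sign_matrix S ** sign_matrix T = sign_matrix (symm_diff S T)"
proof -
  have "(\<Sum>k\<in>UNIV. (if i = k then sign_of S i else 0) * (if k = j then sign_of T k else 0))
      = (if i = j then sign_of S i * sign_of T i else 0)" for i j
    by (subst sum.mono_neutral_cong_right[of UNIV "{i}" _ "\<lambda>k. sign_of S i * (if k = j then sign_of T k else 0)"]) auto
  then show ?thesis
    by (simp add: sign_matrix_def matrix_matrix_mult_def vec_eq_iff sign_of_mult)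
qed

lemma sign_matrix_vec [simp]: "(sign_matrix S *v a) $ i = sign_of S i * a $ i"
proof -
  have "(\<Sum>j\<in>UNIV. (if i = j then sign_of S i else 0) * a $ j)
      = (\<Sum>j\<in>UNIV. if j = i then sign_of S i * a $ j else 0)"
    by (rule sum.cong) auto
  then show ?thesis by (simp add: sign_matrix_def matrix_vector_mult_def)
qed

lemma sign_matrix_empty [simp]: "sign_matrix {} = mat 1"
  by (simp add: sign_matrix_def sign_of_def mat_def vec_eq_iff)

lemma sign_matrix_nth [simp]: "sign_matrix S $ i $ i = sign_of S i"
  by (simp add: sign_matrix_def)

lemma sign_of_eq_1_iff [simp]: "sign_of S i = 1 \<longleftrightarrow> i \<notin> S"
  by (simp add: sign_of_def)

lemma sign_of_eq_iff: "sign_of S i = sign_of T i \<longleftrightarrow> (i \<in> S \<longleftrightarrow> i \<in> T)"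
  by (simp add: sign_of_def)

lemma sign_matrix_eq_iff [simp]: "sign_matrix S = sign_matrix T \<longleftrightarrow> S = T"
proof
  assume "sign_matrix S = sign_matrix T"
  then have "sign_of S i = sign_of T i" for i by (metis sign_matrix_nth)
  then show "S = T" by (auto simp: sign_of_eq_iff)
qed simp

lemma sign_matrix_eq_one_iff [simp]: "sign_matrix S = mat 1 \<longleftrightarrow> S = {}"
  by (metis sign_matrix_empty sign_matrix_eq_iff)

lemma symm_diff_self [simp]: "symm_diff S S = {}"
  by (simp add: symm_diff_def)

lemma unitary_sign_matrix: "unitary_matrix (sign_matrix S)"
proof -
  have "conj_transpose (sign_matrix S) = sign_matrix S"
    by (auto simp: conj_transpose_def sign_matrix_def sign_of_def vec_eq_iff)
  then show ?thesis by (simp add: unitary_matrix_def sign_matrix_mult)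
qed

lemma det_sign_matrix: "det (sign_matrix S) = (- 1) ^ card S"
proof -
  have "det (sign_matrix S) = (\<Prod>i\<in>UNIV. sign_of S i)"
    by (subst det_diagonal) (simp_all add: sign_matrix_def)
  then show ?thesis by (simp add: sign_of_def prod.If_cases)
qed

section \<open>Even sets and weights under symmetric difference\<close>

lemma even_sets_empty [simp]: "{} \<in> even_sets"
  by (simp add: even_sets_def)

lemma card_symm_diff:
  fixes S T :: "'n::finite set"
  shows "card (symm_diff S T) + 2 * card (S \<inter> T) = card S + card T"
proof -
  have "card (symm_diff S T) = card (S - T) + card (T - S)"
    unfolding symm_diff_def by (rule card_Un_disjoint) auto
  moreover have "card S = card (S - T) + card (S \<inter> T)"
    by (metis card_Diff_subset_Int card_mono finite inf_le1 le_add_diff_inverse2)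
  moreover have "card T = card (T - S) + card (S \<inter> T)"
    by (metis card_Diff_subset_Int card_mono finite inf_commute inf_le1 le_add_diff_inverse2)
  ultimately show ?thesis by linarith
qed

lemma even_sets_symm_diff: "S \<in> even_sets \<Longrightarrow> T \<in> even_sets \<Longrightarrow> symm_diff S T \<in> even_sets"
  using card_symm_diff[of S T] unfolding even_sets_def
  by (metis (mono_tags) dvd_triv_left even_add mem_Collect_eq)

text \<open>The part over \<open>S \<inter> T\<close> is counted twice on the right and cancels,
  because every element of \<open>v4\<close> is its own negative.\<close>

lemma weight_symm_diff: "weight u i (symm_diff S T) = weight u i S + weight u i T"
proof -
  have split: "weight u i A = weight u i (A - B) + weight u i (A \<inter> B)" for A B
    unfolding weight_def by (subst sum.Int_Diff[of A _ B]) (simp_all add: add.commute)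
  have "weight u i (symm_diff S T) = weight u i (S - T) + weight u i (T - S)"
    unfolding weight_def symm_diff_def by (rule sum.union_disjoint) auto
  moreover have "weight u i (S \<inter> T) + weight u i (S \<inter> T) = 0" by simp
  ultimately show ?thesis
    using split[of S T] split[of T S] by (simp add: Int_commute algebra_simps)
qed

lemma one_in_gauss_ints [simp]: "1 \<in> gauss_ints"
  by (simp add: gauss_ints_def)

definition gauss_lattice :: "(complex^'n) set" where
  "gauss_lattice = {a. \<forall>i. a $ i \<in> gauss_ints}"

lemma gauss_lattice_closed:
  "0 \<in> gauss_lattice"
  "a \<in> gauss_lattice \<Longrightarrow> b \<in> gauss_lattice \<Longrightarrow> a + b \<in> gauss_lattice"
  "a \<in> gauss_lattice \<Longrightarrow> b \<in> gauss_lattice \<Longrightarrow> a - b \<in> gauss_lattice"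
  "a \<in> gauss_lattice \<Longrightarrow> - a \<in> gauss_lattice"
  "a \<in> gauss_lattice \<Longrightarrow> sign_matrix S *v a \<in> gauss_lattice"
  "z \<in> gauss_ints \<Longrightarrow> axis i z \<in> gauss_lattice"
  by (auto simp: gauss_lattice_def sign_of_def axis_def)

section \<open>The groups attached to a matrix over the Klein four-group\<close>

text \<open>These are the translation parts allowed with linear part \<open>sign_matrix S\<close>.
  The classes of the doubled entries fix \<open>a\<close> modulo
  \<open>gauss_lattice\<close>.\<close>

definition lift :: "('n::finite \<Rightarrow> 'n \<Rightarrow> v4) \<Rightarrow> 'n set \<Rightarrow> complex^'n \<Rightarrow> bool" where
  "lift u S a \<longleftrightarrow> (\<forall>i. 2 * a $ i \<in> gauss_ints \<and> mod2 (2 * a $ i) = weight u i S)"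

definition sign_group :: "('n::finite \<Rightarrow> 'n \<Rightarrow> v4) \<Rightarrow> 'n affine_pair set" where
  "sign_group u = {(sign_matrix S, a) | S a. S \<in> even_sets \<and> lift u S a}"

lemma sign_group_iff [simp]:
  "(sign_matrix S, a) \<in> sign_group u \<longleftrightarrow> S \<in> even_sets \<and> lift u S a"
  by (auto simp: sign_group_def)

lemma sign_groupE:
  assumes "g \<in> sign_group u"
  obtains S a where "g = (sign_matrix S, a)" "S \<in> even_sets" "lift u S a"
  using assms by (auto simp: sign_group_def)

lemma lift_exists: "\<exists>a. lift u S a"
proof -
  have "\<forall>i. \<exists>z\<in>gauss_ints. mod2 z = weight u i S" by (simp add: mod2_surj)
  then obtain f where "\<forall>i. f i \<in> gauss_ints \<and> mod2 (f i) = weight u i S" by metis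
  then show ?thesis unfolding lift_def by (intro exI[of _ "\<chi> i. f i / 2"]) simp
qed

lemma weight_empty [simp]: "weight u i {} = 0"
  by (simp add: weight_def)

text \<open>The empty set has weight 0, so each \<open>2 * a $ i\<close> is twice a Gaussian
  integer. Hence the translation lattice is the same for every \<open>u\<close>.\<close>

lemma lift_empty_iff: "lift u {} a \<longleftrightarrow> a \<in> gauss_lattice"
proof
  assume a: "lift u {} a"
  have "a $ i \<in> gauss_ints" for i
  proof -
    obtain w where "w \<in> gauss_ints" "2 * a $ i = 2 * w"
      using a mod2_eq_0_iff[of "2 * a $ i"] by (auto simp: lift_def)
    then show "a $ i \<in> gauss_ints" by simp
  qed
  then show "a \<in> gauss_lattice" by (simp add: gauss_lattice_def)
qed (auto simp: lift_def gauss_lattice_def)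

lemma translation_in_sign_group [simp]:
  "(mat 1, a) \<in> sign_group u \<longleftrightarrow> a \<in> gauss_lattice"
  using sign_group_iff[of "{}" a u] by (simp add: lift_empty_iff)

text \<open>A sign in front of a Gaussian integer is invisible modulo 2, so doubled translation
  parts add like weights. This gives closure under composition.\<close>

lemma lift_add_signed:
  assumes "lift u S a" "lift u T b"
  shows "lift u (symm_diff S T) (sign_matrix S *v b + a)"
  unfolding lift_def
proof
  fix i
  let ?x = "2 * (sign_matrix S *v b + a) $ i"
  have x: "?x = sign_of S i * (2 * b $ i) + 2 * a $ i" by (simp add: algebra_simps)
  have b: "sign_of S i * (2 * b $ i) \<in> gauss_ints" "mod2 (sign_of S i * (2 * b $ i)) = weight u i T"
    using assms by (simp_all add: lift_def sign_of_def)
  have a: "2 * a $ i \<in> gauss_ints" "mod2 (2 * a $ i) = weight u i S"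
    using assms by (simp_all add: lift_def)
  show "?x \<in> gauss_ints \<and> mod2 ?x = weight u i (symm_diff S T)"
    unfolding x weight_symm_diff using a b by (simp add: mod2_add gauss_ints_add add.commute)
qed

lemma unitary_affine_mult [simp]:
  "(A, a) \<otimes>\<^bsub>unitary_affine\<^esub> (B, b) = (A ** B, A *v b + a)"
  by (simp add: unitary_affine_def)

lemma unitary_affine_one [simp]: "\<one>\<^bsub>unitary_affine\<^esub> = (mat 1, 0)"
  by (simp add: unitary_affine_def)

lemma sign_matrix_vec_twice [simp]: "sign_matrix S *v (sign_matrix S *v a) = a"
  by (simp add: matrix_vector_mul_assoc sign_matrix_mult)

lemma subgroup_sign_group: "subgroup (sign_group u) (unitary_affine :: ('n::finite) affine_pair monoid)"
proof -
  interpret group "unitary_affine :: 'n affine_pair monoid" by (rule group_unitary_affine)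
  have carr: "(sign_matrix S, a) \<in> carrier unitary_affine" for S and a :: "complex^'n"
    by (simp add: unitary_affine_def unitary_sign_matrix)
  show ?thesis
  proof (rule subgroupI)
    show "sign_group u \<subseteq> carrier unitary_affine"
      by (auto elim!: sign_groupE simp: carr)
    have "(mat 1, 0) \<in> sign_group u" by (simp add: gauss_lattice_closed)
    then show "sign_group u \<noteq> {}" by blast
  next
    fix g assume "g \<in> sign_group u"
    then obtain S a where g: "g = (sign_matrix S, a)" "S \<in> even_sets" "lift u S a"
      by (rule sign_groupE)
    let ?h = "(sign_matrix S, - (sign_matrix S *v a))"
    have "inv\<^bsub>unitary_affine\<^esub> g = ?h"
      using g carr by (intro inv_equality) (simp_all add: sign_matrix_mult)
    moreover have "lift u S (- (sign_matrix S *v a))"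
      using g(3) by (simp add: lift_def sign_of_def)
    ultimately show "inv\<^bsub>unitary_affine\<^esub> g \<in> sign_group u" using g by simp
  next
    fix g h assume "g \<in> sign_group u" "h \<in> sign_group u"
    then show "g \<otimes>\<^bsub>unitary_affine\<^esub> h \<in> sign_group u"
      by (auto elim!: sign_groupE simp: sign_matrix_mult even_sets_symm_diff lift_add_signed)
  qed
qed

section \<open>Discreteness, cocompactness and torsion-freeness\<close>

lemma gauss_ints_norm_ge_1:
  assumes "z \<in> gauss_ints" "z \<noteq> 0"
  shows "norm z \<ge> 1"
proof -
  have "1 \<le> \<bar>Re z\<bar> \<or> 1 \<le> \<bar>Im z\<bar>"
    using assms by (auto simp: gauss_ints_def complex_eq_iff intro: Ints_nonzero_abs_ge1)
  then show ?thesis using abs_Re_le_cmod[of z] abs_Im_le_cmod[of z] by linarith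
qed

text \<open>Distinct elements lie at least 1/2 apart: different sign matrices differ by 2 in some
  entry, and twice the difference of two translation parts has Gaussian integer entries.\<close>

lemma discrete_sign_group: "discrete (sign_group (u :: 'n::finite \<Rightarrow> 'n \<Rightarrow> v4))"
proof -
  have "g = h" if g: "g \<in> sign_group u" and h: "h \<in> sign_group u" and d: "dist g h < 1 / 2"
    for g h :: "'n affine_pair"
  proof -
    obtain S a where S: "g = (sign_matrix S, a)" "lift u S a" using g by (rule sign_groupE)
    obtain T b where T: "h = (sign_matrix T, b)" "lift u T b" using h by (rule sign_groupE)
    have "dist (sign_matrix S) (sign_matrix T) < 1 / 2"
      using dist_fst_le[of g h] d by (simp add: S T)
    then have "dist (sign_of S i) (sign_of T i) < 1 / 2" for i
      using dist_vec_nth_le[of "sign_matrix S" i "sign_matrix T"]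
        dist_vec_nth_le[of "sign_matrix S $ i" i "sign_matrix T $ i"] by simp
    then have ST: "S = T"
      by (force simp: sign_of_def dist_norm split: if_splits)
    have "a $ i = b $ i" for i
    proof (rule ccontr)
      assume "a $ i \<noteq> b $ i"
      have "2 * a $ i - 2 * b $ i \<in> gauss_ints"
        using S T by (intro gauss_ints_diff) (simp_all add: lift_def)
      then have "1 \<le> norm (2 * a $ i - 2 * b $ i)"
        using \<open>a $ i \<noteq> b $ i\<close> by (intro gauss_ints_norm_ge_1) auto
      also have "\<dots> = 2 * dist (a $ i) (b $ i)"
        by (metis dist_norm norm_mult norm_numeral right_diff_distrib)
      also have "\<dots> \<le> 2 * dist a b" by (simp add: dist_vec_nth_le)
      also have "\<dots> \<le> 2 * dist g h" using dist_snd_le[of g h] by (simp add: S T)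
      finally show False using d by simp
    qed
    then show ?thesis using S T ST by (simp add: vec_eq_iff)
  qed
  then have "uniform_discrete (sign_group u)"
    unfolding uniform_discrete_def by (intro exI[of _ "1 / 2"]) auto
  then show ?thesis by (rule uniform_discrete_imp_discrete)
qed

lemma norm_unitary_entry_le_1:
  assumes "unitary_matrix A"
  shows "norm (A $ i $ j) \<le> 1"
proof -
  have "(A ** conj_transpose A) $ i $ i = 1"
    using assms by (simp add: unitary_matrix_def mat_def)
  then have "(\<Sum>k\<in>UNIV. A $ i $ k * cnj (A $ i $ k)) = 1"
    by (simp add: matrix_matrix_mult_def conj_transpose_def)
  then have "complex_of_real (\<Sum>k\<in>UNIV. (norm (A $ i $ k))\<^sup>2) = 1"
    by (simp only: of_real_sum complex_norm_square)
  then have "(\<Sum>k\<in>UNIV. (norm (A $ i $ k))\<^sup>2) = 1"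
    using of_real_eq_1_iff by blast
  moreover have "(norm (A $ i $ j))\<^sup>2 \<le> (\<Sum>k\<in>UNIV. (norm (A $ i $ k))\<^sup>2)"
    by (rule member_le_sum) auto
  ultimately show ?thesis using power2_le_iff_abs_le[of 1 "norm (A $ i $ j)"] by simp
qed

lemma norm_vec_le_sum: "norm x \<le> (\<Sum>i\<in>UNIV. norm (x $ i))"
  unfolding norm_vec_def by (rule L2_set_le_sum) simp

lemma compact_unitary: "compact {A :: complex^'n^'n. unitary_matrix A}"
proof -
  have "norm A \<le> real CARD('n) * real CARD('n)" if "unitary_matrix A" for A :: "complex^'n^'n"
  proof -
    have "norm (A $ i) \<le> real CARD('n)" for i
      using norm_vec_le_sum[of "A $ i"] sum_bounded_above[of UNIV "\<lambda>j. norm (A $ i $ j)" 1]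
        norm_unitary_entry_le_1[OF that] by fastforce
    then show ?thesis
      using norm_vec_le_sum[of A] sum_bounded_above[of UNIV "\<lambda>i. norm (A $ i)" "real CARD('n)"]
      by fastforce
  qed
  then have "bounded {A :: complex^'n^'n. unitary_matrix A}"
    unfolding bounded_iff by blast
  moreover have "closed {A :: complex^'n^'n. unitary_matrix A}"
    unfolding unitary_matrix_def conj_transpose_def matrix_matrix_mult_def
    by (intro closed_Collect_conj closed_Collect_eq continuous_intros)
  ultimately show ?thesis by (simp add: compact_eq_bounded_closed)
qed

text \<open>A compact set meeting every coset suffices, since the quotient map is continuous. The
  unitary factor is compact, and lattice translations reduce the translation part to a bounded
  one.\<close>

lemma cocompact_sign_group: "cocompact (sign_group (u :: 'n::finite \<Rightarrow> 'n \<Rightarrow> v4))"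
proof -
  interpret group "unitary_affine :: 'n affine_pair monoid" by (rule group_unitary_affine)
  let ?X = "top_of_set (carrier unitary_affine :: 'n affine_pair set)"
  let ?f = "\<lambda>g. g <#\<^bsub>unitary_affine\<^esub> sign_group u"
  define C where "C = {A :: complex^'n^'n. unitary_matrix A} \<times> cball (0 :: complex^'n) (2 * real CARD('n))"
  \<comment> \<open>Right multiplication of \<open>(A, v)\<close> by a translation \<open>l\<close>
    adds \<open>A *v l\<close>. The second component is therefore written as \<open>A *v x\<close>,
    with \<open>x\<close> the vector to be reduced.\<close>
  define K where "K = (\<lambda>(A, x). (A, A *v x)) ` C"
  have "continuous_on C (\<lambda>(A, x). (A, A *v x))"
    unfolding case_prod_unfold matrix_vector_mult_def by (intro continuous_intros)
  moreover have "compact C"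
    unfolding C_def by (intro compact_Times compact_unitary compact_cball)
  ultimately have "compact K" unfolding K_def by (rule compact_continuous_image)
  have K: "K \<subseteq> carrier unitary_affine"
    by (auto simp: K_def C_def unitary_affine_def)
  have q: "quotient_map ?X (quotient_topology ?X ?f) ?f"
    by (rule quotient_map_quotient_topology)
  have "?f g \<in> ?f ` K" if g: "g \<in> carrier unitary_affine" for g
  proof -
    obtain A v where Av: "g = (A, v)" by (cases g)
    have A: "unitary_matrix A" using g Av by (simp add: unitary_affine_def)
    define w where "w = conj_transpose A *v v"
    \<comment> \<open>Removing integer parts leaves entries of norm at most 2, whence the radius of
      the ball in \<open>C\<close>.\<close>
    define l where "l = (\<chi> i. Complex (of_int \<lfloor>Re (w $ i)\<rfloor>) (of_int \<lfloor>Im (w $ i)\<rfloor>))"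
    have Aw: "A *v w = v"
      using A by (simp add: w_def matrix_vector_mul_assoc unitary_matrix_def)
    have "norm ((w - l) $ i) \<le> 2" for i
    proof -
      have "\<bar>Re ((w - l) $ i)\<bar> \<le> 1" "\<bar>Im ((w - l) $ i)\<bar> \<le> 1"
        unfolding l_def by (simp; linarith)+
      then show ?thesis using cmod_le[of "(w - l) $ i"] by linarith
    qed
    then have "norm (w - l) \<le> 2 * real CARD('n)"
      using norm_vec_le_sum[of "w - l"] sum_bounded_above[of UNIV "\<lambda>i. norm ((w - l) $ i)" 2]
      by (simp add: mult.commute)
    then have "(A, A *v (w - l)) \<in> K" using A by (auto simp: K_def C_def)
    moreover have "A *v (w - l) = A *v (- l) + v"
      using matrix_vector_right_distrib[of A "- l" w] by (simp add: Aw)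
    then have "(A, A *v (w - l)) = g \<otimes>\<^bsub>unitary_affine\<^esub> (mat 1, - l)"
      by (simp add: Av)
    moreover have "(mat 1, - l) \<in> sign_group u"
      by (simp add: l_def gauss_lattice_def gauss_ints_def)
    then have "g \<otimes>\<^bsub>unitary_affine\<^esub> (mat 1, - l) \<in> g <#\<^bsub>unitary_affine\<^esub> sign_group u"
      unfolding l_coset_def by blast
    then have "?f g = ?f (g \<otimes>\<^bsub>unitary_affine\<^esub> (mat 1, - l))"
      using g subgroup_sign_group by (rule l_repr_independence)
    ultimately show ?thesis by force
  qed
  then have "?f ` K = ?f ` carrier unitary_affine" using K by blast
  moreover have "compactin (quotient_topology ?X ?f) (?f ` K)"
    using \<open>compact K\<close> K by (intro image_compactin[OF _ quotient_imp_continuous_map[OF q]])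
      (simp add: compactin_subtopology)
  ultimately show ?thesis
    unfolding cocompact_def compact_space_def using quotient_imp_surjective_map[OF q] by simp
qed

text \<open>A coordinate outside \<open>S\<close> is never reflected, so the \<open>k\<close>-th
  power moves it by \<open>k\<close> times \<open>a $ i\<close>. Torsion forces
  \<open>a $ i = 0\<close> there, contradicting a nonzero weight unless \<open>S\<close> is
  empty.\<close>

lemma torsion_free_sign_group:
  assumes "admissible u"
  shows "torsion_free (subgroup_of (sign_group u))"
  unfolding torsion_free_def
proof (intro ballI allI impI)
  let ?G = "subgroup_of (sign_group u)"
  fix x and k :: nat
  assume "x \<in> carrier ?G" and k: "k > 0" and xk: "x [^]\<^bsub>?G\<^esub> k = \<one>\<^bsub>?G\<^esub>"
  then obtain S a where x: "x = (sign_matrix S, a)" "S \<in> even_sets" "lift u S a"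
    by (auto elim: sign_groupE)
  have pow: "\<exists>T b. x [^]\<^bsub>?G\<^esub> m = (sign_matrix T, b) \<and> i \<notin> T \<and> b $ i = of_nat m * a $ i"
    if "i \<notin> S" for i and m :: nat
  proof (induction m)
    case 0
    then show ?case by (auto intro!: exI[of _ "{}"] exI[of _ 0])
  next
    case (Suc m)
    then obtain T b where "x [^]\<^bsub>?G\<^esub> m = (sign_matrix T, b)" "i \<notin> T" "b $ i = of_nat m * a $ i"
      by blast
    then show ?case using that
      by (intro exI[of _ "symm_diff T S"] exI[of _ "sign_matrix T *v a + b"])
        (simp add: x sign_matrix_mult symm_diff_def sign_of_def algebra_simps)
  qed
  have a: "a $ i = 0" if "i \<notin> S" for i
    using pow[OF that, of k] xk k by auto
  have "S = {}"
  proof (rule ccontr)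
    assume "S \<noteq> {}"
    then obtain i where "i \<notin> S" "weight u i S \<noteq> 0"
      using assms x by (auto simp: admissible_def)
    moreover have "mod2 (2 * a $ i) = weight u i S" using x by (simp add: lift_def)
    ultimately show False using a[of i] by simp
  qed
  then show "x = \<one>\<^bsub>?G\<^esub>" using a x by (simp add: vec_eq_iff)
qed

section \<open>Holonomy and its diagonal representation\<close>

lemma holonomy_sign_group: "holonomy (sign_group u) = sign_matrix ` even_sets"
  using lift_exists by (fastforce simp: holonomy_def sign_group_def image_iff)

text \<open>An even set is determined by its trace on all coordinates but one, and each subset of
  those becomes even by putting in or leaving out the last coordinate \<open>l\<close>.\<close>

lemma even_sets_iso:
  "unitary_group\<lparr>carrier := sign_matrix ` (even_sets :: 'n::finite set set)\<rparr> \<cong>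
    product_group {..<CARD('n) - 1} (\<lambda>_. integer_mod_group 2)"
proof -
  let ?N = "{..<CARD('n) - 1}"
  obtain e where e: "bij_betw e {..<CARD('n)} (UNIV :: 'n set)"
    using ex_bij_betw_nat_finite[of "UNIV :: 'n set"] by (auto simp: atLeast0LessThan)
  define f where "f M = (\<lambda>k\<in>?N. if M $ e k $ e k = (1::complex) then 0 else 1 :: int)" for M :: "complex^'n^'n"
  have f: "f (sign_matrix S) = (\<lambda>k\<in>?N. if e k \<in> S then 1 else 0)" for S
    by (auto simp: f_def)
  define l where "l = e (CARD('n) - 1)"
  have e_eq: "e k = e m \<longleftrightarrow> k = m" if "k < CARD('n)" "m < CARD('n)" for k m
    using e that by (auto simp: bij_betw_def inj_on_def)
  have cases: "i = l \<or> (\<exists>k\<in>?N. i = e k)" for i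
  proof -
    have "i \<in> e ` {..<CARD('n)}" using e by (simp add: bij_betw_def)
    then obtain k where k: "k < CARD('n)" "i = e k" by auto
    then show ?thesis by (cases "k = CARD('n) - 1") (auto simp: l_def)
  qed
  have l: "e k \<noteq> l" if "k \<in> ?N" for k
    using that by (simp add: l_def e_eq)
  have f_carrier: "f (sign_matrix S) \<in> carrier (product_group ?N (\<lambda>_. integer_mod_group 2))" for S
    unfolding f by (simp only: carrier_product_group restrict_PiE_iff) (simp add: carrier_integer_mod_group)
  have "f \<in> hom (unitary_group\<lparr>carrier := sign_matrix ` even_sets\<rparr>)
    (product_group ?N (\<lambda>_. integer_mod_group 2))"
  proof (rule homI)
    let ?G = "unitary_group\<lparr>carrier := sign_matrix ` (even_sets :: 'n set set)\<rparr>"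
    fix x y assume "x \<in> carrier ?G" "y \<in> carrier ?G"
    then obtain S T where "x = sign_matrix S" "y = sign_matrix T" by auto
    then show "f (x \<otimes>\<^bsub>?G\<^esub> y) = f x \<otimes>\<^bsub>product_group ?N (\<lambda>_. integer_mod_group 2)\<^esub> f y"
      by (auto simp: f unitary_group_def sign_matrix_mult symm_diff_def)
  qed (use f_carrier in auto)
  moreover have "inj_on f (sign_matrix ` even_sets)"
  proof (rule inj_onI, elim imageE, hypsubst)
    fix S T :: "'n set" assume ST: "S \<in> even_sets" "T \<in> even_sets"
      and eq: "f (sign_matrix S) = f (sign_matrix T)"
    have iff: "e k \<in> S \<longleftrightarrow> e k \<in> T" if "k \<in> ?N" for k
      using fun_cong[OF eq, of k] that by (auto simp: f split: if_splits)
    \<comment> \<open>The sets agree away from \<open>l\<close>, and an even symmetric difference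
      cannot be \<open>{l}\<close>.\<close>
    have "symm_diff S T \<subseteq> {l}"
      using iff cases by (fastforce simp: symm_diff_def)
    then have "symm_diff S T = {} \<or> symm_diff S T = {l}" by blast
    moreover have "even (card (symm_diff S T))"
      using even_sets_symm_diff[OF ST] by (simp add: even_sets_def)
    ultimately have "symm_diff S T = {}" by auto
    then show "sign_matrix S = sign_matrix T" by (auto simp: symm_diff_def)
  qed
  moreover have "f ` sign_matrix ` even_sets = carrier (product_group ?N (\<lambda>_. integer_mod_group 2))"
  proof (rule equalityI)
    show "f ` sign_matrix ` even_sets \<subseteq> carrier (product_group ?N (\<lambda>_. integer_mod_group 2))"
      using f_carrier by blast
  next
    show "carrier (product_group ?N (\<lambda>_. integer_mod_group 2)) \<subseteq> f ` sign_matrix ` even_sets"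
    proof
      fix x assume x: "x \<in> carrier (product_group ?N (\<lambda>_. integer_mod_group 2))"
      define S where "S = e ` {k\<in>?N. x k = 1}"
      define T where "T = (if even (card S) then S else insert l S)"
      have lS: "l \<notin> S" using l by (auto simp: S_def)
      then have "T \<in> even_sets" by (simp add: T_def even_sets_def)
      have T: "e k \<in> T \<longleftrightarrow> x k = 1" if "k \<in> ?N" for k
      proof -
        have "e k \<in> S \<longleftrightarrow> x k = 1" using that by (auto simp: S_def e_eq)
        then show ?thesis using l[OF that] by (simp add: T_def)
      qed
      have "x k = (if e k \<in> T then 1 else 0)" if "k \<in> ?N" for k
      proof -
        have "x k \<in> {0..<2}" using x that by (auto simp: PiE_iff carrier_integer_mod_group)
        then have "x k = 0 \<or> x k = 1" by auto
        then show ?thesis using T[OF that] by auto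
      qed
      then have "x = f (sign_matrix T)"
        using x unfolding f by (intro ext) (auto simp: PiE_iff extensional_def)
      then show "x \<in> f ` sign_matrix ` even_sets" using \<open>T \<in> even_sets\<close> by blast
    qed
  qed
  ultimately show ?thesis unfolding is_iso_def iso_def bij_betw_def by auto
qed

lemma translation_lattice_sign_group:
  "translation_lattice (sign_group u) = gauss_lattice"
  by (simp add: translation_lattice_def)

lemma gauss_lattice_iff_Basis:
  fixes v :: "complex^'n"
  shows "v \<in> gauss_lattice \<longleftrightarrow> (\<forall>b\<in>Basis. v \<bullet> b \<in> \<int>)"
  by (auto simp: gauss_lattice_def Basis_vec_def Basis_complex_def inner_axis gauss_ints_def)

text \<open>The Euclidean basis consists of the vectors \<open>axis i 1\<close> and
  \<open>axis i \<i>\<close>; inner products with it recover the integer coefficients.\<close>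

lemma int_basis_Basis: "int_basis Basis (gauss_lattice :: (complex^'n) set)"
proof -
  interpret Z: module "int_scale :: int \<Rightarrow> complex^'n \<Rightarrow> complex^'n" by (rule module_int_scale)
  have comp: "(\<Sum>v\<in>Basis. int_scale (c v) v) \<bullet> b = of_int (c b)"
    if "b \<in> Basis" for c and b :: "complex^'n"
    using that by (simp add: int_scale_def inner_sum_left_Basis)
  have "\<not> Z.dependent (Basis :: (complex^'n) set)"
    unfolding Z.dependent_finite[OF finite_Basis]
  proof (intro notI, elim exE conjE bexE)
    fix c :: "complex^'n \<Rightarrow> int" and b :: "complex^'n"
    assume "(\<Sum>v\<in>Basis. int_scale (c v) v) = 0" "b \<in> Basis" "c b \<noteq> 0"
    then show False using comp[of b c] by simp
  qed
  moreover have "Z.span Basis = (gauss_lattice :: (complex^'n) set)"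
    unfolding Z.span_finite[OF finite_Basis]
  proof (rule equalityI; rule subsetI)
    fix v :: "complex^'n"
    assume "v \<in> range (\<lambda>c. \<Sum>v\<in>Basis. int_scale (c v) v)"
    then show "v \<in> gauss_lattice" by (auto simp: comp gauss_lattice_iff_Basis)
  next
    fix v :: "complex^'n"
    assume v: "v \<in> gauss_lattice"
    have "v = (\<Sum>b\<in>Basis. int_scale \<lfloor>v \<bullet> b\<rfloor> b)"
    proof (rule euclidean_eqI)
      fix b :: "complex^'n"
      assume b: "b \<in> Basis"
      then obtain k where k: "v \<bullet> b = of_int k" using v by (auto simp: gauss_lattice_iff_Basis elim: Ints_cases)
      have "(\<Sum>b\<in>Basis. int_scale \<lfloor>v \<bullet> b\<rfloor> b) \<bullet> b = of_int \<lfloor>v \<bullet> b\<rfloor>"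
        by (rule comp[OF b])
      then show "v \<bullet> b = (\<Sum>b\<in>Basis. int_scale \<lfloor>v \<bullet> b\<rfloor> b) \<bullet> b" by (simp add: k)
    qed
    then show "v \<in> range (\<lambda>c. \<Sum>v\<in>Basis. int_scale (c v) v)"
      by (intro range_eqI[of _ _ "\<lambda>b. \<lfloor>v \<bullet> b\<rfloor>"])
  qed
  ultimately show ?thesis by (simp add: int_basis_def)
qed

text \<open>Conjugation acts on translations through the linear part, and a basis vector lies on one
  coordinate axis, so it only changes by a sign.\<close>

lemma diagonal_holonomy_rep_sign_group:
  "diagonal_holonomy_rep (sign_group (u :: 'n::finite \<Rightarrow> 'n \<Rightarrow> v4))"
  unfolding diagonal_holonomy_rep_def translation_lattice_sign_group
proof (rule exI[of _ Basis], rule conjI[OF int_basis_Basis], intro ballI)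
  fix g :: "'n affine_pair" and b :: "complex^'n"
  assume g: "g \<in> sign_group u" and "b \<in> Basis"
  then obtain i z where b: "b = axis i z" by (auto simp: Basis_vec_def)
  obtain S a where S: "g = (sign_matrix S, a)" using g by (rule sign_groupE)
  have "g \<in> carrier unitary_affine"
    by (simp add: S unitary_affine_def unitary_sign_matrix)
  moreover have "sign_matrix S *v b = int_scale (if i \<in> S then - 1 else 1) b"
    by (auto simp: b vec_eq_iff axis_def int_scale_def sign_of_def)
  ultimately show "\<exists>d. g \<otimes>\<^bsub>unitary_affine\<^esub> (mat 1, b) \<otimes>\<^bsub>unitary_affine\<^esub> inv\<^bsub>unitary_affine\<^esub> g
      = (mat 1, int_scale d b)"
    using conjugate_translation[of g b] by (auto simp: S)
qed

lemma sign_group_in_diagonal_chw_groups: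
  fixes u :: "'n::finite \<Rightarrow> 'n \<Rightarrow> v4"
  assumes "admissible u"
  shows "sign_group u \<in> diagonal_chw_groups"
proof -
  have "flat_kaehler_group (sign_group u)"
    unfolding flat_kaehler_group_def
    by (intro conjI subgroup_sign_group discrete_sign_group cocompact_sign_group
        torsion_free_sign_group assms)
  moreover have "holonomy (sign_group u) \<subseteq> special_unitary"
    by (auto simp: holonomy_sign_group special_unitary_def unitary_sign_matrix det_sign_matrix
        even_sets_def)
  ultimately show ?thesis
    using even_sets_iso[where 'n='n] diagonal_holonomy_rep_sign_group
    by (simp add: diagonal_chw_groups_def chw_group_def holonomy_sign_group)
qed

section \<open>Isomorphisms\<close>

text \<open>Sign matrices are involutions, so all squares are translations. Conversely, the
  translation by 2 along an axis is a square, and commuting with it keeps \<open>i\<close> out of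
  \<open>S\<close>. The criterion is purely group-theoretic, hence respected by
  isomorphisms.\<close>

lemma translation_iff_commutes_with_squares:
  assumes "g \<in> sign_group u"
  shows "fst g = mat 1 \<longleftrightarrow> (\<forall>h\<in>sign_group u.
    g \<otimes>\<^bsub>unitary_affine\<^esub> (h \<otimes>\<^bsub>unitary_affine\<^esub> h)
      = (h \<otimes>\<^bsub>unitary_affine\<^esub> h) \<otimes>\<^bsub>unitary_affine\<^esub> g)"
    (is "_ \<longleftrightarrow> (\<forall>h\<in>_. ?P h)")
proof
  assume g: "fst g = mat 1"
  show "\<forall>h\<in>sign_group u. ?P h"
  proof
    fix h assume "h \<in> sign_group u"
    then obtain T b where "h = (sign_matrix T, b)" by (rule sign_groupE)
    then show "?P h" using g by (cases g) (simp add: sign_matrix_mult add.commute)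
  qed
next
  assume comm: "\<forall>h\<in>sign_group u. ?P h"
  obtain S a where g: "g = (sign_matrix S, a)" using assms by (rule sign_groupE)
  have "i \<notin> S" for i
  proof
    assume "i \<in> S"
    have "?P (mat 1, axis i 1)"
      using bspec[OF comm, of "(mat 1, axis i 1)"]
      by (simp only: translation_in_sign_group gauss_lattice_closed one_in_gauss_ints)
    then have "(sign_matrix S *v (axis i 1 + axis i 1) + a) $ i = (a + (axis i 1 + axis i 1)) $ i"
      by (simp add: g)
    then show False using \<open>i \<in> S\<close> by (simp add: sign_of_def axis_def)
  qed
  then show "fst g = mat 1" by (auto simp: g)
qed

text \<open>The vectors fixed by \<open>sign_matrix T\<close> are those vanishing on
  \<open>T\<close>, and an index in \<open>S - T\<close> is detected by its axis vector. Inclusion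
  thus becomes visible in the action on the lattice.\<close>

lemma subset_iff_fixed_vectors:
  "S \<subseteq> T \<longleftrightarrow> (\<forall>x\<in>gauss_lattice. sign_matrix T *v x = x \<longrightarrow> sign_matrix S *v x = x)"
proof
  assume "S \<subseteq> T"
  show "\<forall>x\<in>gauss_lattice. sign_matrix T *v x = x \<longrightarrow> sign_matrix S *v x = x"
  proof (intro ballI impI)
    fix x :: "complex^'a" assume T: "sign_matrix T *v x = x"
    have "sign_of S i * x $ i = x $ i" for i
    proof (cases "i \<in> T")
      case True
      have "sign_of T i * x $ i = x $ i" using T by (metis sign_matrix_vec)
      then have "x $ i = 0" using True by (simp add: sign_of_def)
      then show ?thesis by simp
    next
      case False
      then show ?thesis using \<open>S \<subseteq> T\<close> by (auto simp: sign_of_def)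
    qed
    then show "sign_matrix S *v x = x" by (simp add: vec_eq_iff)
  qed
next
  assume fixed: "\<forall>x\<in>gauss_lattice. sign_matrix T *v x = x \<longrightarrow> sign_matrix S *v x = x"
  show "S \<subseteq> T"
  proof (rule subsetI, rule ccontr)
    fix i assume i: "i \<in> S" "i \<notin> T"
    have "sign_matrix T *v axis i 1 = axis i 1"
      using i by (auto simp: vec_eq_iff axis_def sign_of_def)
    then have "sign_matrix S *v axis i 1 = axis i 1"
      using fixed by (simp add: gauss_lattice_closed)
    then have "sign_of S i * axis i 1 $ i = axis i 1 $ i" by (metis sign_matrix_vec)
    then show False using i by (simp add: sign_of_def axis_def)
  qed
qed

section \<open>The lattice map induced by an isomorphism\<close>

locale sign_group_iso =
  fixes u v :: "'n::finite \<Rightarrow> 'n \<Rightarrow> v4" and \<phi>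
  assumes iso: "\<phi> \<in> iso (subgroup_of (sign_group u)) (subgroup_of (sign_group v))"
    and odd_dim: "odd CARD('n)"
begin

lemma bij: "bij_betw \<phi> (sign_group u) (sign_group v)"
  using iso by (simp add: iso_def)

lemma \<phi>_in [simp]: "g \<in> sign_group u \<Longrightarrow> \<phi> g \<in> sign_group v"
  using bij by (auto simp: bij_betw_def)

lemma hom: "g \<in> sign_group u \<Longrightarrow> h \<in> sign_group u \<Longrightarrow>
    \<phi> (g \<otimes>\<^bsub>unitary_affine\<^esub> h) = \<phi> g \<otimes>\<^bsub>unitary_affine\<^esub> \<phi> h"
  using iso by (simp add: iso_def hom_def)

lemma mult_closed: "g \<in> sign_group w \<Longrightarrow> h \<in> sign_group w \<Longrightarrow>
    g \<otimes>\<^bsub>unitary_affine\<^esub> h \<in> sign_group w"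
  by (rule subgroup.m_closed[OF subgroup_sign_group])

lemma translation_iff:
  assumes g: "g \<in> sign_group u"
  shows "fst (\<phi> g) = mat 1 \<longleftrightarrow> fst g = mat 1"
proof -
  have "(g \<otimes>\<^bsub>unitary_affine\<^esub> (h \<otimes>\<^bsub>unitary_affine\<^esub> h) = (h \<otimes>\<^bsub>unitary_affine\<^esub> h) \<otimes>\<^bsub>unitary_affine\<^esub> g)
    \<longleftrightarrow> (\<phi> g \<otimes>\<^bsub>unitary_affine\<^esub> (\<phi> h \<otimes>\<^bsub>unitary_affine\<^esub> \<phi> h)
      = (\<phi> h \<otimes>\<^bsub>unitary_affine\<^esub> \<phi> h) \<otimes>\<^bsub>unitary_affine\<^esub> \<phi> g)"
    if h: "h \<in> sign_group u" for h
    using inj_on_eq_iff[OF bij_betw_imp_inj_on[OF bij],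
        of "g \<otimes>\<^bsub>unitary_affine\<^esub> (h \<otimes>\<^bsub>unitary_affine\<^esub> h)" "(h \<otimes>\<^bsub>unitary_affine\<^esub> h) \<otimes>\<^bsub>unitary_affine\<^esub> g"]
      g h by (simp add: hom mult_closed)
  moreover have "sign_group v = \<phi> ` sign_group u" using bij by (simp add: bij_betw_def)
  ultimately show ?thesis
    using translation_iff_commutes_with_squares[OF g]
      translation_iff_commutes_with_squares[of "\<phi> g" v] g by simp
qed

definition A :: "complex^'n \<Rightarrow> complex^'n" where
  "A x = snd (\<phi> (mat 1, x))"

lemma \<phi>_translation:
  assumes "x \<in> gauss_lattice"
  shows "\<phi> (mat 1, x) = (mat 1, A x)"
  using translation_iff[of "(mat 1, x)"] assms
  by (simp add: A_def prod_eq_iff)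

lemma A_in [simp]: "x \<in> gauss_lattice \<Longrightarrow> A x \<in> gauss_lattice"
  by (metis \<phi>_in \<phi>_translation translation_in_sign_group)

lemma A_add: "x \<in> gauss_lattice \<Longrightarrow> y \<in> gauss_lattice \<Longrightarrow> A (x + y) = A x + A y"
  using hom[of "(mat 1, y)" "(mat 1, x)"]
  by (simp add: \<phi>_translation gauss_lattice_closed)

lemma A_0 [simp]: "A 0 = 0"
  using A_add[of 0 0] by (simp add: gauss_lattice_closed)

lemma A_minus: "x \<in> gauss_lattice \<Longrightarrow> A (- x) = - A x"
  using A_add[of "- x" x] by (simp add: gauss_lattice_closed eq_neg_iff_add_eq_0)

lemma A_diff: "x \<in> gauss_lattice \<Longrightarrow> y \<in> gauss_lattice \<Longrightarrow> A (x - y) = A x - A y"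
  using A_add[of x "- y"] by (simp add: gauss_lattice_closed A_minus)

lemma A_eq_iff:
  assumes "x \<in> gauss_lattice" "y \<in> gauss_lattice"
  shows "A x = A y \<longleftrightarrow> x = y"
  using inj_on_eq_iff[OF bij_betw_imp_inj_on[OF bij], of "(mat 1, x)" "(mat 1, y)"] assms
  by (simp add: \<phi>_translation)

lemma A_surj:
  assumes "y \<in> gauss_lattice"
  obtains x where "x \<in> gauss_lattice" "A x = y"
proof -
  have "(mat 1, y) \<in> \<phi> ` sign_group u"
    using bij assms by (simp add: bij_betw_def)
  then obtain g where g: "g \<in> sign_group u" "\<phi> g = (mat 1, y)" by auto
  then have "g = (mat 1, snd g)" using translation_iff[of g] by (simp add: prod_eq_iff)
  then have "snd g \<in> gauss_lattice" "A (snd g) = y"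
    using g by (metis translation_in_sign_group, metis A_def snd_conv)
  then show ?thesis by (rule that)
qed

text \<open>Moving a translation by \<open>x\<close> from the right of
  \<open>(sign_matrix S, a)\<close> to its left turns it into one by
  \<open>sign_matrix S *v x\<close>; \<open>\<phi>\<close> is applied to both products.\<close>

lemma A_intertwines:
  assumes S: "(sign_matrix S, a) \<in> sign_group u"
    and T: "\<phi> (sign_matrix S, a) = (sign_matrix T, b)" and x: "x \<in> gauss_lattice"
  shows "A (sign_matrix S *v x) = sign_matrix T *v A x"
proof -
  have "\<phi> ((sign_matrix S, a) \<otimes>\<^bsub>unitary_affine\<^esub> (mat 1, x))
      = (sign_matrix T, b) \<otimes>\<^bsub>unitary_affine\<^esub> (mat 1, A x)"
    using S T x by (subst hom) (simp_all add: \<phi>_translation)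
  moreover have "\<phi> ((mat 1, sign_matrix S *v x) \<otimes>\<^bsub>unitary_affine\<^esub> (sign_matrix S, a))
      = (mat 1, A (sign_matrix S *v x)) \<otimes>\<^bsub>unitary_affine\<^esub> (sign_matrix T, b)"
    using S T x
    by (subst hom) (simp_all add: \<phi>_translation gauss_lattice_closed)
  ultimately show ?thesis by (simp add: add.commute)
qed

text \<open>\<open>A\<close> is a bijection of the lattice that matches the fixed vectors of
  \<open>sign_matrix S\<close> with those of \<open>sign_matrix T\<close>. As the lifts are
  arbitrary, \<open>T\<close> depends on \<open>S\<close> alone.\<close>

lemma subset_transfer:
  assumes S: "(sign_matrix S, a) \<in> sign_group u" "\<phi> (sign_matrix S, a) = (sign_matrix T, b)"
    and S': "(sign_matrix S', a') \<in> sign_group u" "\<phi> (sign_matrix S', a') = (sign_matrix T', b')"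
  shows "S \<subseteq> S' \<longleftrightarrow> T \<subseteq> T'"
proof -
  have fix_iff: "sign_matrix S *v x = x \<longleftrightarrow> sign_matrix T *v A x = A x"
    if "x \<in> gauss_lattice"
      "(sign_matrix S, a) \<in> sign_group u" "\<phi> (sign_matrix S, a) = (sign_matrix T, b)" for x S T a b
    using A_intertwines[OF that(2,3,1)] A_eq_iff[of "sign_matrix S *v x" x] that(1)
    by (simp add: gauss_lattice_closed)
  have "(\<forall>y\<in>gauss_lattice. sign_matrix T' *v y = y \<longrightarrow> sign_matrix T *v y = y)
    \<longleftrightarrow> (\<forall>x\<in>gauss_lattice. sign_matrix T' *v A x = A x \<longrightarrow> sign_matrix T *v A x = A x)"
    by (metis A_in A_surj)
  then show ?thesis
    unfolding subset_iff_fixed_vectors using fix_iff[OF _ S] fix_iff[OF _ S'] by simp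
qed

section \<open>The permutation of the coordinates\<close>

lemma image_exists:
  assumes "S \<in> even_sets"
  shows "\<exists>T\<in>even_sets. \<exists>a b. lift u S a \<and> lift v T b \<and> \<phi> (sign_matrix S, a) = (sign_matrix T, b)"
proof -
  obtain a where a: "lift u S a" using lift_exists by blast
  then have "\<phi> (sign_matrix S, a) \<in> sign_group v" using assms by simp
  then show ?thesis using a by (metis sign_groupE)
qed

text \<open>This is the map induced on holonomy groups, written on index sets; the choice is
  harmless, since \<open>T\<close> does not depend on the lift.\<close>

definition \<sigma> :: "'n set \<Rightarrow> 'n set" where
  "\<sigma> S = (SOME T. T \<in> even_sets \<and>
    (\<exists>a b. lift u S a \<and> lift v T b \<and> \<phi> (sign_matrix S, a) = (sign_matrix T, b)))"

lemma \<sigma>: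
  assumes "S \<in> even_sets"
  shows \<sigma>_even: "\<sigma> S \<in> even_sets"
    and \<sigma>_lift: "\<exists>a b. lift u S a \<and> lift v (\<sigma> S) b \<and> \<phi> (sign_matrix S, a) = (sign_matrix (\<sigma> S), b)"
  using someI_ex[OF image_exists[OF assms, unfolded Bex_def], folded \<sigma>_def] by blast+

lemma \<sigma>_subset_iff:
  assumes "S \<in> even_sets" "S' \<in> even_sets"
  shows "\<sigma> S \<subseteq> \<sigma> S' \<longleftrightarrow> S \<subseteq> S'"
proof -
  obtain a b a' b' where "lift u S a" "\<phi> (sign_matrix S, a) = (sign_matrix (\<sigma> S), b)"
    "lift u S' a'" "\<phi> (sign_matrix S', a') = (sign_matrix (\<sigma> S'), b')"
    using assms \<sigma>_lift by metis
  then show ?thesis using subset_transfer[of S a "\<sigma> S" b S' a' "\<sigma> S'" b'] assms by simp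
qed

lemma \<sigma>_surj:
  assumes "T \<in> even_sets"
  obtains S where "S \<in> even_sets" "\<sigma> S = T"
proof -
  obtain b where "lift v T b" using lift_exists by blast
  then have "(sign_matrix T, b) \<in> \<phi> ` sign_group u"
    using bij assms by (simp add: bij_betw_def)
  then obtain g where g: "g \<in> sign_group u" "\<phi> g = (sign_matrix T, b)" by auto
  then obtain S a where S: "g = (sign_matrix S, a)" "S \<in> even_sets" "lift u S a"
    by (metis sign_groupE)
  obtain a' b' where "lift u S a'" "\<phi> (sign_matrix S, a') = (sign_matrix (\<sigma> S), b')"
    using \<sigma>_lift[OF S(2)] by blast
  \<comment> \<open>The lift behind \<open>\<sigma> S\<close> may differ from the one in
    \<open>g\<close>; inclusion in both directions identifies the images.\<close>
  then have "\<sigma> S = T"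
    using subset_transfer[of S a T b S a' "\<sigma> S" b'] subset_transfer[of S a' "\<sigma> S" b' S a T b] g S
    by auto
  then show ?thesis using S(2) that by blast
qed

lemma co_singleton_even: "- {i :: 'n} \<in> even_sets"
  using odd_dim card_Compl[of "{i}"] by (simp add: even_sets_def)

lemma even_not_UNIV: "S \<in> even_sets \<Longrightarrow> S \<noteq> (UNIV :: 'n set)"
  using odd_dim by (auto simp: even_sets_def)

text \<open>In odd dimension the complements of points are the maximal sets of even size.\<close>

lemma \<sigma>_co_singleton: "\<exists>k. \<sigma> (- {i}) = - {k}"
proof -
  obtain k where k: "k \<notin> \<sigma> (- {i})"
    using even_not_UNIV[OF \<sigma>_even[OF co_singleton_even]] by blast
  obtain S where S: "S \<in> even_sets" "\<sigma> S = - {k}"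
    using \<sigma>_surj[OF co_singleton_even] by blast
  then have "- {i} \<subseteq> S" using \<sigma>_subset_iff[OF co_singleton_even S(1), of i] k by auto
  then have "S = - {i}" using even_not_UNIV[OF S(1)] by auto
  then show ?thesis using S by blast
qed

definition \<pi> :: "'n \<Rightarrow> 'n" where
  "\<pi> i = (SOME k. \<sigma> (- {i}) = - {k})"

lemma \<pi>: "\<sigma> (- {i}) = - {\<pi> i}"
  unfolding \<pi>_def by (rule someI_ex[OF \<sigma>_co_singleton])

lemma bij_\<pi>: "bij \<pi>"
proof -
  have "inj \<pi>"
  proof (rule injI)
    fix i j assume "\<pi> i = \<pi> j"
    then have "\<sigma> (- {i}) = \<sigma> (- {j})" by (simp add: \<pi>)
    then have "- {i} \<subseteq> - {j}" using \<sigma>_subset_iff[OF co_singleton_even co_singleton_even] by blast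
    then show "i = j" by auto
  qed
  then show ?thesis by (simp add: bij_def finite_UNIV_inj_surj)
qed

text \<open>\<open>i \<notin> S\<close> says \<open>S \<subseteq> - {i}\<close>, so membership is an
  instance of the inclusion that \<open>\<sigma>\<close> preserves.\<close>

lemma mem_\<sigma>_iff:
  assumes "S \<in> even_sets"
  shows "\<pi> i \<in> \<sigma> S \<longleftrightarrow> i \<in> S"
  using \<sigma>_subset_iff[OF assms co_singleton_even, of i] by (auto simp: \<pi>)

lemma \<sigma>_eq_image:
  assumes "S \<in> even_sets"
  shows "\<sigma> S = \<pi> ` S"
proof (rule Set.set_eqI)
  fix k
  obtain i where k: "k = \<pi> i" using bij_\<pi> by (metis bij_pointE)
  show "k \<in> \<sigma> S \<longleftrightarrow> k \<in> \<pi> ` S"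
    using bij_\<pi> by (simp add: k mem_\<sigma>_iff[OF assms] bij_is_inj inj_image_mem_iff)
qed

section \<open>Action on a single coordinate modulo 2\<close>

definition \<alpha> :: "'n \<Rightarrow> complex \<Rightarrow> complex" where
  "\<alpha> i z = A (axis i z) $ \<pi> i"

text \<open>The sign matrix of \<open>- {i}\<close> negates \<open>x\<close>, while that of
  \<open>- {\<pi> i}\<close> fixes the coordinate \<open>\<pi> i\<close>. So this coordinate of
  \<open>A x\<close> equals its own negative.\<close>

lemma A_component_0:
  assumes x: "x \<in> gauss_lattice" "x $ i = 0"
  shows "A x $ \<pi> i = 0"
proof -
  obtain a b where "lift u (- {i}) a" "\<phi> (sign_matrix (- {i}), a) = (sign_matrix (- {\<pi> i}), b)"
    using \<sigma>_lift[OF co_singleton_even, of i] by (auto simp: \<pi>)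
  then have "A (sign_matrix (- {i}) *v x) = sign_matrix (- {\<pi> i}) *v A x"
    by (intro A_intertwines x(1)) (simp_all add: co_singleton_even)
  moreover have "sign_matrix (- {i}) *v x = - x"
    using x(2) by (auto simp: vec_eq_iff sign_of_def)
  ultimately have "- A x $ \<pi> i = (sign_matrix (- {\<pi> i}) *v A x) $ \<pi> i"
    using A_minus[OF x(1)] by (metis vector_uminus_component)
  then show ?thesis by (simp add: sign_of_def)
qed

lemma A_component:
  assumes x: "x \<in> gauss_lattice"
  shows "A x $ \<pi> i = \<alpha> i (x $ i)"
proof -
  have i: "axis i (x $ i) \<in> gauss_lattice"
    using x by (intro gauss_lattice_closed) (simp add: gauss_lattice_def)
  have "A (x - axis i (x $ i)) $ \<pi> i = 0"
    by (rule A_component_0[OF gauss_lattice_closed(3)[OF x i]]) (simp add: axis_def)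
  then show ?thesis using A_diff[OF x i] by (simp add: \<alpha>_def)
qed

lemma axis_add: "axis i (x + y) = axis i x + (axis i y :: complex^'n)"
  by (simp add: vec_eq_iff axis_def)

lemma \<alpha>_add: "x \<in> gauss_ints \<Longrightarrow> y \<in> gauss_ints \<Longrightarrow> \<alpha> i (x + y) = \<alpha> i x + \<alpha> i y"
  by (simp add: \<alpha>_def axis_add A_add gauss_lattice_closed)

lemma \<alpha>_in: "x \<in> gauss_ints \<Longrightarrow> \<alpha> i x \<in> gauss_ints"
  using A_in[OF gauss_lattice_closed(6)] unfolding \<alpha>_def gauss_lattice_def by blast

definition rep :: "v4 \<Rightarrow> complex" where
  "rep w = (SOME z. z \<in> gauss_ints \<and> mod2 z = w)"

lemma rep: "rep w \<in> gauss_ints" "mod2 (rep w) = w"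
  using someI_ex[OF mod2_surj[of w, unfolded Bex_def], folded rep_def] by auto

definition M :: "'n \<Rightarrow> v4 \<Rightarrow> v4" where
  "M i w = mod2 (\<alpha> i (rep w))"

text \<open>Two representatives of a class differ by some \<open>2 * y\<close>, which the additive
  map \<open>\<alpha> i\<close> sends to \<open>2 * \<alpha> i y\<close>. Hence \<open>M i\<close>
  is independent of the choice in \<open>rep\<close>.\<close>

lemma mod2_\<alpha>:
  assumes z: "z \<in> gauss_ints"
  shows "mod2 (\<alpha> i z) = M i (mod2 z)"
proof -
  let ?r = "rep (mod2 z)"
  have d: "z - ?r \<in> gauss_ints" using z rep by blast
  have "mod2 (z - ?r) = 0" using mod2_add[OF d rep(1), of "mod2 z"] by (simp add: rep)
  then obtain y where y: "y \<in> gauss_ints" "z - ?r = 2 * y" using mod2_eq_0_iff[OF d] by auto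
  have "\<alpha> i z = \<alpha> i (y + y) + \<alpha> i ?r"
    using \<alpha>_add[OF d rep(1), of i "mod2 z", unfolded diff_add_cancel] by (simp only: y(2) mult_2)
  also have "\<alpha> i (y + y) = 2 * \<alpha> i y" using \<alpha>_add[OF y(1) y(1)] by (simp only: mult_2)
  finally show ?thesis using y(1) rep(1) by (simp add: mod2_add \<alpha>_in gauss_ints_double M_def)
qed

lemma M_add: "M i (w + w') = M i w + M i w'"
  using mod2_\<alpha>[of "rep w + rep w'" i] rep
  by (simp add: \<alpha>_add mod2_add \<alpha>_in gauss_ints_add M_def)

lemma bij_M: "bij (M i)"
proof -
  have "\<exists>w'. M i w' = w" for w
  proof -
    have "axis (\<pi> i) (rep w) \<in> gauss_lattice" by (simp add: gauss_lattice_closed rep)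
    then obtain x where x: "x \<in> gauss_lattice" "A x = axis (\<pi> i) (rep w)" by (rule A_surj)
    have "\<alpha> i (x $ i) = rep w" using A_component[OF x(1), of i] x(2) by (simp add: axis_def)
    then have "M i (mod2 (x $ i)) = w"
      using x(1) mod2_\<alpha>[of "x $ i" i] by (simp add: gauss_lattice_def rep)
    then show ?thesis ..
  qed
  then have "surj (M i)" by (metis surjI)
  then show ?thesis by (simp add: bij_def finite_UNIV_surj_inj)
qed

text \<open>The square of a lift of \<open>S\<close> translates coordinate \<open>i\<close> by
  \<open>2 * a $ i\<close>, whose class is the weight. Since \<open>\<phi>\<close> preserves
  squares, \<open>\<alpha> i\<close> sends this number to \<open>2 * b $ \<pi> i\<close>.\<close>

lemma weight_transfer:
  assumes S: "S \<in> even_sets" "i \<notin> S"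
  shows "weight v (\<pi> i) (\<pi> ` S) = M i (weight u i S)"
proof -
  obtain a b where a: "lift u S a" and b: "lift v (\<sigma> S) b"
    and ab: "\<phi> (sign_matrix S, a) = (sign_matrix (\<sigma> S), b)"
    using \<sigma>_lift[OF S(1)] by blast
  have L: "sign_matrix S *v a + a \<in> gauss_lattice"
    using lift_add_signed[OF a a] by (simp add: lift_empty_iff gauss_lattice_def)
  have "A (sign_matrix S *v a + a) = sign_matrix (\<sigma> S) *v b + b"
    using hom[of "(sign_matrix S, a)" "(sign_matrix S, a)"] S a ab \<phi>_translation[OF L]
    by (simp add: sign_matrix_mult)
  then have "\<alpha> i (2 * a $ i) = 2 * b $ \<pi> i"
    using A_component[OF L, of i] S mem_\<sigma>_iff[OF S(1), of i] by (simp add: sign_of_def)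
  then show ?thesis
    using a b mod2_\<alpha>[of "2 * a $ i" i] by (simp add: lift_def \<sigma>_eq_image[OF S(1)])
qed

text \<open>Two-element sets avoiding \<open>i\<close> show that the discrepancy is the same at all
  off-diagonal places of row \<open>i\<close>. The diagonal entry occurs in no set avoiding
  \<open>i\<close> and gets a constant of its own.\<close>

lemma entries:
  "\<exists>c d. \<forall>i j. v (\<pi> i) (\<pi> j) = M i (u i j) + (if i = j then c i else d i)"
proof -
  \<comment> \<open>The discrepancy between both sides; in \<open>v4\<close> sum and difference
    coincide.\<close>
  define e where "e i j = v (\<pi> i) (\<pi> j) + M i (u i j)" for i j
  have const: "e i j = e i k" if "j \<noteq> i" "k \<noteq> i" for i j k
  proof (cases "j = k")
    case False
    have "weight v (\<pi> i) (\<pi> ` {j, k}) = M i (weight u i {j, k})"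
      using that False by (intro weight_transfer) (auto simp: even_sets_def)
    moreover have "\<pi> j \<noteq> \<pi> k" using False bij_\<pi> by (auto simp: bij_def inj_def)
    ultimately have "v (\<pi> i) (\<pi> j) + v (\<pi> i) (\<pi> k) = M i (u i j) + M i (u i k)"
      using False by (simp add: weight_def M_add)
    moreover have "e i j + e i k
        = (v (\<pi> i) (\<pi> j) + v (\<pi> i) (\<pi> k)) + (M i (u i j) + M i (u i k))"
      by (simp only: e_def add_ac)
    ultimately have "e i j + e i k = 0" by (simp only: v4_double)
    then show ?thesis using eq_neg_iff_add_eq_0[of "e i j" "e i k"] by simp
  qed simp
  \<comment> \<open>Any off-diagonal column serves as reference; one exists as soon as some
    \<open>j\<close> differs from \<open>i\<close>.\<close>
  define d where "d i = e i (SOME k. k \<noteq> i)" for i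
  have "e i j = d i" if "i \<noteq> j" for i j
    unfolding d_def by (rule const) (use that someI[of "\<lambda>k. k \<noteq> i" j] in auto)
  then have "e i j = (if i = j then e i i else d i)" for i j by simp
  moreover have "v (\<pi> i) (\<pi> j) = M i (u i j) + e i j" for i j
    by (simp add: e_def add.left_commute[of "M i (u i j)"])
  ultimately have "\<forall>i j. v (\<pi> i) (\<pi> j) = M i (u i j) + (if i = j then e i i else d i)"
    by simp
  then show ?thesis by (intro exI[of _ "\<lambda>i. e i i"] exI[of _ d])
qed

end

text \<open>Recording only that \<open>M i\<close> is a bijection fixing 0 loses nothing: every
  permutation of the three nonzero elements of \<open>v4\<close> is additive.\<close>

lemma sign_group_iso_entries:
  fixes u v :: "'n::finite \<Rightarrow> 'n \<Rightarrow> v4"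
  assumes "subgroup_of (sign_group u) \<cong> subgroup_of (sign_group v)" "odd CARD('n)"
  shows "\<exists>\<pi> M c d. bij \<pi> \<and> (\<forall>i. bij (M i) \<and> M i 0 = (0 :: v4)) \<and>
    (\<forall>i j. v (\<pi> i) (\<pi> j) = M i (u i j) + (if i = j then c i else d i))"
proof -
  obtain \<phi> where "\<phi> \<in> iso (subgroup_of (sign_group u)) (subgroup_of (sign_group v))"
    using assms(1) by (auto simp: is_iso_def)
  then interpret sign_group_iso u v \<phi> using assms(2) by unfold_locales
  have "M i 0 = 0" for i using M_add[of i 0 0] by simp
  then show ?thesis using entries bij_\<pi> bij_M by blast
qed

section \<open>Counting isomorphism classes\<close>

text \<open>The relation between the entries of \<open>u\<close> and \<open>v\<close>, solved for
  \<open>v\<close> by inverting the permutation.\<close>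

definition transform ::
  "(7 \<Rightarrow> 7 \<Rightarrow> v4) \<Rightarrow> (7 \<Rightarrow> 7) \<times> (7 \<Rightarrow> v4 \<Rightarrow> v4) \<times> (7 \<Rightarrow> v4) \<times> (7 \<Rightarrow> v4) \<Rightarrow> 7 \<Rightarrow> 7 \<Rightarrow> v4" where
  "transform u = (\<lambda>(p, M, c, d) i j. let k = inv_into UNIV p i; l = inv_into UNIV p j
    in M k (u k l) + (if k = l then c k else d k))"

definition params :: "((7 \<Rightarrow> 7) \<times> (7 \<Rightarrow> v4 \<Rightarrow> v4) \<times> (7 \<Rightarrow> v4) \<times> (7 \<Rightarrow> v4)) set" where
  "params = {p. p permutes UNIV} \<times> {M. \<forall>i. M i permutes - {0}} \<times> UNIV \<times> UNIV"

text \<open>There are 7! = 5040 permutations of the coordinates, 3! = 6 choices for each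
  \<open>M i\<close>, and \<open>4 ^ 7\<close> choices for each of \<open>c\<close> and
  \<open>d\<close>.\<close>

lemma card_params: "card params = 5040 * 6 ^ 7 * 4 ^ 14"
proof -
  have "card {p :: 7 \<Rightarrow> 7. p permutes UNIV} = 5040"
    using card_permutations[of "UNIV :: 7 set" 7] by (simp add: fact_numeral)
  moreover have "card {M :: 7 \<Rightarrow> v4 \<Rightarrow> v4. \<forall>i. M i permutes - {0}} = 6 ^ 7"
  proof -
    have "card (- {0 :: v4}) = 3" by (simp add: card_Compl card_bit)
    then have "card {f :: v4 \<Rightarrow> v4. f permutes - {0}} = 6"
      using card_permutations[of "- {0 :: v4}" 3] by (simp add: fact_numeral)
    then show ?thesis
      using card_functions_pointwise[of "\<lambda>(i :: 7) (f :: v4 \<Rightarrow> v4). f permutes - {0}"] by simp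
  qed
  moreover have "CARD(7 \<Rightarrow> v4) = 4 ^ 7" by (simp add: card_fun card_bit)
  ultimately show ?thesis unfolding params_def
    by (simp only: card_cartesian_product) simp
qed

lemma iso_sign_group_in_transforms:
  fixes u v :: "7 \<Rightarrow> 7 \<Rightarrow> v4"
  assumes "subgroup_of (sign_group u) \<cong> subgroup_of (sign_group v)"
  shows "v \<in> transform u ` params"
proof -
  have "odd CARD(7)" by simp
  from sign_group_iso_entries[OF assms this] obtain p M c d where p: "bij p" and M: "\<And>i. bij (M i)" "\<And>i. M i 0 = (0 :: v4)"
    and v: "\<And>i j. v (p i) (p j) = M i (u i j) + (if i = j then c i else d i)"
    by blast
  have "M i permutes - {0}" for i
    unfolding permutes_def using M(2)[of i] bij_iff[of "M i"] M(1)[of i] by simp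
  then have "(p, M, c, d) \<in> params"
    using p by (simp add: params_def permutes_def bij_iff)
  moreover have "v = transform u (p, M, c, d)"
  proof (intro ext)
    fix i j
    show "v i j = transform u (p, M, c, d) i j"
      using v[of "inv_into UNIV p i" "inv_into UNIV p j"] p by (simp add: transform_def Let_def bij_is_surj surj_f_inv_f)
  qed
  ultimately show ?thesis by (rule image_eqI[rotated])
qed

theorem proposition4:
  shows "{..<48321790784 :: nat} \<prec>
    (diagonal_chw_groups :: 7 affine_pair set set) // iso_rel"
proof (cases "finite ((diagonal_chw_groups :: 7 affine_pair set set) // iso_rel)")
  \<comment> \<open>Infinitely many classes dominate any finite set; \<open>card\<close> is
    informative only in the other case.\<close>
  case False
  then show ?thesis by (intro finite_lesspoll_infinite) simp_all
next
  case fin: True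
  let ?Q = "(diagonal_chw_groups :: 7 affine_pair set set) // iso_rel"
  define T where "T = {u :: 7 \<Rightarrow> 7 \<Rightarrow> v4. admissible u}"
  define cls where "cls u = iso_rel `` {sign_group u}" for u :: "7 \<Rightarrow> 7 \<Rightarrow> v4"
  have T: "sign_group u \<in> diagonal_chw_groups" if "u \<in> T" for u
    using that by (simp add: T_def sign_group_in_diagonal_chw_groups)
  \<comment> \<open>All matrices whose groups lie in one class are transforms of a single one of
    them.\<close>
  have fibre: "card {u \<in> T. cls u = q} \<le> 5040 * 6 ^ 7 * 4 ^ 14" for q
  proof (cases "\<exists>u\<in>T. cls u = q")
    case True
    then obtain u where u: "u \<in> T" "cls u = q" by blast
    have "{v \<in> T. cls v = q} \<subseteq> transform u ` params"
    proof
      fix v assume "v \<in> {v \<in> T. cls v = q}"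
      then have "(sign_group u, sign_group v) \<in> iso_rel"
        using u T by (intro eq_equiv_class[OF _ equiv_iso_rel]) (auto simp: cls_def)
      then show "v \<in> transform u ` params"
        by (intro iso_sign_group_in_transforms) (simp add: iso_rel_def)
    qed
    then have "card {v \<in> T. cls v = q} \<le> card (transform u ` params)"
      by (intro card_mono) simp_all
    also have "\<dots> \<le> card params" by (rule card_image_le) simp
    finally show ?thesis by (simp only: card_params)
  next
    case False
    then have "{u \<in> T. cls u = q} = {}" by blast
    then show ?thesis by (simp only: card.empty)
  qed
  have "3 ^ 7 * 443 * 4 ^ 37 \<le> card T"
    unfolding T_def by (rule card_admissible)
  also have "T = (\<Union>q\<in>?Q. {u \<in> T. cls u = q})"
    using T by (auto simp: cls_def intro: quotientI)
  also have "card \<dots> \<le> (\<Sum>q\<in>?Q. card {u \<in> T. cls u = q})"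
    by (rule card_UN_le[OF fin])
  also have "\<dots> \<le> card ?Q * (5040 * 6 ^ 7 * 4 ^ 14)"
    using sum_bounded_above[of ?Q "\<lambda>q. card {u \<in> T. cls u = q}", OF fibre] by simp
  \<comment> \<open>The inequality is strict because
    \<open>2 ^ 35 * 443 = 315 * 48321790784 + 64\<close>.\<close>
  finally have "48321790784 < card ?Q" by simp
  then show ?thesis
    unfolding lesspoll_def using fin by (simp add: lepoll_iff_card_le eqpoll_iff_card)
qed

end
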